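(* Let $G$ be a bidirected graph with vertices $1,\dots,t$, and let $\mathcal A$ be a complex matrix representation of $G$ of dimension $(n_1,\dots,n_t)$. There exist positive real numbers $\varepsilon$ and $K$ with the following property: for every complex matrix representation $\mathcal B$ of $G$ that is isomorphic to $\mathcal A$ and satisfies $\|\mathcal B-\mathcal A\|<\varepsilon$, there exists an isomorphism $\varphi=(S_1,\dots,S_t)$ from $\mathcal B$ to $\mathcal A$ such that $$\|S_1-I_{n_1}\|+\dots+\|S_t-I_{n_t}\|\le K\|\mathcal B-\mathcal A\|.$$
   Context: A bidirected graph $G$ is a graph with vertices $1,2,\dots,t$ ($t\ge 1$) and finitely many edges, each of which is undirected ($i - j$), directed ($i\to j$), or bidirected ($i\leftrightarrow j$); multiple edges and loops are allowed. A representation $\mathcal A$ of $G$ over a field $\mathbb F$ assigns: a finite dimensional vector space $\mathcal A_i$ over $\mathbb F$ to each vertex $i$; a bilinear form $\mathcal A_\alpha:\mathcal A_j\times\mathcal A_i\to\mathbb F$ to each undirected edge $\alpha: i - j$ with $i\le j$; a linear mapping $\mathcal A_\beta:\mathcal A_i\to\mathcal A_j$ to each directed edge $\beta:i\to j$; and a bilinear form on dual spaces $\mathcal A_\gamma:\mathcal A_j^*\times\mathcal A_i^*\to\mathbb F$ to each bidirected edge $\gamma:i\leftrightarrow j$ with $i\le j$ (here $V^*$ is the space of all linear forms $V\to\mathbb F$). The dimension of $\mathcal A$ is the vector $(\dim\mathcal A_1,\dots,\dim\mathcal A_t)$. An isomorphism $\varphi:\mathcal A\to\mathcal B$ of two representations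 of $G$ of the same dimension is a system $\varphi=(\varphi_1,\dots,\varphi_t)$ of linear bijections $\varphi_i:\mathcal A_i\to\mathcal B_i$ such that: $\mathcal A_\alpha(x,y)=\mathcal B_\alpha(\varphi_j x,\varphi_i y)$ for each undirected edge $\alpha:i - j$ ($i\le j$); $\varphi_j\mathcal A_\beta=\mathcal B_\beta\varphi_i$ for each directed edge $\beta:i\to j$; and $\mathcal A_\gamma(\varphi_j^*x,\varphi_i^*y)=\mathcal B_\gamma(x,y)$ for each bidirected edge $\gamma:i\leftrightarrow j$ ($i\le j$), where $\varphi_i^*:\mathcal B_i^*\to\mathcal A_i^*$ is the dual map. Two representations are isomorphic if such an isomorphism exists. A complex matrix representation is a representation over $\mathbb C$ in which each $\mathcal A_i$ is $\mathbb C^{n_i}$; all its forms and mappings are given by their complex matrices in the standard bases (and, for bidirected edges, the dual bases), so it amounts to assigning an $n_j\times n_i$ matrix to each edge $i - j$ ($i\le j$), $i\to j$, $i\leftrightarrow j$ ($i\le j$). In matrix terms, nonsingular matrices $S_i\in\mathbb C^{n_i\times n_i}$ form an isomorphism $(S_1,\dots,S_t):\mathcal B\to\mathcal A$ if and only if $\mathcal B_\alpha=S_j^T\mathcal A_\alpha S_i$ for undirected $\alpha:i - j$ ($i\le j$), $\mathcal B_\beta=S_j^{-1}\mathcal A_\beta S_i$ for directed $\beta:i\to j$, and $S_j\mathcal B_\gamma S_i^T=\mathcal A_\gamma$ for bidirected $\gamma:i\leftrightarrow j$ ($i\le j$). The norm of a complex matrix $A=[a_{ij}]$ is the Frobenius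 norm $\|A\|=\sqrt{\sum_{i,j}|a_{ij}|^2}$. The norm $\|\mathcal A\|$ of a matrix representation is the sum of the norms of its matrices over all edges; $\mathcal B-\mathcal A$ denotes the matrix representation of the same dimension whose matrices are the differences of the corresponding matrices, so $\|\mathcal B-\mathcal A\|$ is the sum over all edges of the norms of these differences. $I_n$ is the $n\times n$ identity matrix. *)

theory Defs
  imports "Jordan_Normal_Form.Matrix" "Jordan_Normal_Form.Determinant"
begin

section \<open>Bidirected graphs\<close>

text \<open>An undirected or bidirected edge between the vertices \<open>i\<close> and \<open>j\<close> is recorded with its
  endpoints in the order \<open>i \<le> j\<close>, which is the order that the notion of a representation refers to.
  Edges carry labels of an arbitrary type, so that multiple edges are possible.\<close>

datatype edge_ends = Undirected nat nat | Directed nat nat | Bidirected nat nat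

record 'e bidir_graph =
  vertex_count :: nat
  edge_set :: "'e set"
  ends_of :: "'e \<Rightarrow> edge_ends"

fun wf_ends :: "nat \<Rightarrow> edge_ends \<Rightarrow> bool" where
  "wf_ends t (Undirected i j) \<longleftrightarrow> i \<in> {1..t} \<and> j \<in> {1..t} \<and> i \<le> j"
| "wf_ends t (Directed i j) \<longleftrightarrow> i \<in> {1..t} \<and> j \<in> {1..t}"
| "wf_ends t (Bidirected i j) \<longleftrightarrow> i \<in> {1..t} \<and> j \<in> {1..t} \<and> i \<le> j"

definition bidirected_graph :: "'e bidir_graph \<Rightarrow> bool" where
  "bidirected_graph G \<longleftrightarrow> vertex_count G \<ge> 1 \<and> finite (edge_set G) \<and>
     (\<forall>e\<in>edge_set G. wf_ends (vertex_count G) (ends_of G e))"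

fun edge_src :: "edge_ends \<Rightarrow> nat" where
  "edge_src (Undirected i j) = i"
| "edge_src (Directed i j) = i"
| "edge_src (Bidirected i j) = i"

fun edge_tgt :: "edge_ends \<Rightarrow> nat" where
  "edge_tgt (Undirected i j) = j"
| "edge_tgt (Directed i j) = j"
| "edge_tgt (Bidirected i j) = j"


section \<open>Complex matrix representations\<close>

text \<open>The space at vertex \<open>i\<close> is \<open>carrier_vec (n i)\<close>, where \<open>n\<close> is the dimension vector.\<close>

definition matrix_rep :: "'e bidir_graph \<Rightarrow> (nat \<Rightarrow> nat) \<Rightarrow> ('e \<Rightarrow> complex mat) \<Rightarrow> bool" where
  "matrix_rep G n A \<longleftrightarrow>
     (\<forall>e\<in>edge_set G. A e \<in> carrier_mat (n (edge_tgt (ends_of G e))) (n (edge_src (ends_of G e))))"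

definition frob_norm :: "complex mat \<Rightarrow> real" where
  "frob_norm M = sqrt (\<Sum>i<dim_row M. \<Sum>j<dim_col M. (cmod (M $$ (i, j)))\<^sup>2)"

definition rep_norm :: "'e bidir_graph \<Rightarrow> ('e \<Rightarrow> complex mat) \<Rightarrow> real" where
  "rep_norm G A = (\<Sum>e\<in>edge_set G. frob_norm (A e))"

definition rep_diff :: "('e \<Rightarrow> complex mat) \<Rightarrow> ('e \<Rightarrow> complex mat) \<Rightarrow> ('e \<Rightarrow> complex mat)" where
  "rep_diff B A = (\<lambda>e. B e - A e)"


section \<open>Isomorphisms\<close>

definition linear_on_vec :: "nat \<Rightarrow> nat \<Rightarrow> (complex vec \<Rightarrow> complex vec) \<Rightarrow> bool" where
  "linear_on_vec m k f \<longleftrightarrow> f \<in> carrier_vec m \<rightarrow> carrier_vec k \<and>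
     (\<forall>x\<in>carrier_vec m. \<forall>y\<in>carrier_vec m. f (x + y) = f x + f y) \<and>
     (\<forall>c. \<forall>x\<in>carrier_vec m. f (c \<cdot>\<^sub>v x) = c \<cdot>\<^sub>v f x)"

definition dual_vecs :: "nat \<Rightarrow> (complex vec \<Rightarrow> complex) set" where
  "dual_vecs m = {\<xi>. (\<forall>x\<in>carrier_vec m. \<forall>y\<in>carrier_vec m. \<xi> (x + y) = \<xi> x + \<xi> y) \<and>
     (\<forall>c. \<forall>x\<in>carrier_vec m. \<xi> (c \<cdot>\<^sub>v x) = c * \<xi> x)}"

definition dual_map :: "(complex vec \<Rightarrow> complex vec) \<Rightarrow> (complex vec \<Rightarrow> complex) \<Rightarrow> (complex vec \<Rightarrow> complex)" where
  "dual_map f \<xi> = \<xi> \<circ> f"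

text \<open>The product \<open>\<bullet>\<close> of vectors is bilinear (no complex conjugation).\<close>

definition mat_form :: "complex mat \<Rightarrow> complex vec \<Rightarrow> complex vec \<Rightarrow> complex" where
  "mat_form M x y = x \<bullet> (M *\<^sub>v y)"

definition dual_coords :: "nat \<Rightarrow> (complex vec \<Rightarrow> complex) \<Rightarrow> complex vec" where
  "dual_coords m \<xi> = vec m (\<lambda>k. \<xi> (unit_vec m k))"

definition mat_dual_form :: "complex mat \<Rightarrow> (complex vec \<Rightarrow> complex) \<Rightarrow> (complex vec \<Rightarrow> complex) \<Rightarrow> complex" where
  "mat_dual_form M \<xi> \<eta> = mat_form M (dual_coords (dim_row M) \<xi>) (dual_coords (dim_col M) \<eta>)"

text \<open>Compatibility of \<open>\<phi>\<close> with the matrices \<open>M\<close> (of the source representation) and \<open>N\<close>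
  (of the target representation) of one edge.\<close>

fun edge_compat :: "(nat \<Rightarrow> nat) \<Rightarrow> (nat \<Rightarrow> complex vec \<Rightarrow> complex vec) \<Rightarrow> edge_ends
    \<Rightarrow> complex mat \<Rightarrow> complex mat \<Rightarrow> bool" where
  "edge_compat n \<phi> (Undirected i j) M N \<longleftrightarrow>
     (\<forall>x\<in>carrier_vec (n j). \<forall>y\<in>carrier_vec (n i). mat_form M x y = mat_form N (\<phi> j x) (\<phi> i y))"
| "edge_compat n \<phi> (Directed i j) M N \<longleftrightarrow>
     (\<forall>x\<in>carrier_vec (n i). \<phi> j (M *\<^sub>v x) = N *\<^sub>v (\<phi> i x))"
| "edge_compat n \<phi> (Bidirected i j) M N \<longleftrightarrow>
     (\<forall>\<xi>\<in>dual_vecs (n j). \<forall>\<eta>\<in>dual_vecs (n i).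
        mat_dual_form M (dual_map (\<phi> j) \<xi>) (dual_map (\<phi> i) \<eta>) = mat_dual_form N \<xi> \<eta>)"

definition rep_isomorphism :: "'e bidir_graph \<Rightarrow> (nat \<Rightarrow> nat) \<Rightarrow> ('e \<Rightarrow> complex mat) \<Rightarrow> ('e \<Rightarrow> complex mat)
    \<Rightarrow> (nat \<Rightarrow> complex vec \<Rightarrow> complex vec) \<Rightarrow> bool" where
  "rep_isomorphism G n A B \<phi> \<longleftrightarrow>
     (\<forall>i\<in>{1..vertex_count G}. linear_on_vec (n i) (n i) (\<phi> i) \<and>
        bij_betw (\<phi> i) (carrier_vec (n i)) (carrier_vec (n i))) \<and>
     (\<forall>e\<in>edge_set G. edge_compat n \<phi> (ends_of G e) (A e) (B e))"

definition rep_isomorphic :: "'e bidir_graph \<Rightarrow> (nat \<Rightarrow> nat) \<Rightarrow> ('e \<Rightarrow> complex mat) \<Rightarrow> ('e \<Rightarrow> complex mat) \<Rightarrow> bool" where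
  "rep_isomorphic G n A B \<longleftrightarrow> (\<exists>\<phi>. rep_isomorphism G n A B \<phi>)"

definition mat_isomorphism :: "'e bidir_graph \<Rightarrow> (nat \<Rightarrow> nat) \<Rightarrow> ('e \<Rightarrow> complex mat) \<Rightarrow> ('e \<Rightarrow> complex mat)
    \<Rightarrow> (nat \<Rightarrow> complex mat) \<Rightarrow> bool" where
  "mat_isomorphism G n A B S \<longleftrightarrow>
     (\<forall>i\<in>{1..vertex_count G}. S i \<in> carrier_mat (n i) (n i)) \<and>
     rep_isomorphism G n A B (\<lambda>i x. S i *\<^sub>v x)"


section \<open>Isomorphisms in matrix terms\<close>

lemma mat_form_unit:
  assumes M: "M \<in> carrier_mat a b" and kl: "k < a" "l < b"
  shows "mat_form M (unit_vec a k) (unit_vec b l) = M $$ (k, l)"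
proof -
  have "M *\<^sub>v unit_vec b l = col M l"
    using M kl by (intro eq_vecI) auto
  thus ?thesis using M kl by (simp add: mat_form_def scalar_prod_left_unit)
qed

lemma mat_form_eq_iff:
  assumes M: "M \<in> carrier_mat a b" and N: "N \<in> carrier_mat a b"
  shows "(\<forall>x\<in>carrier_vec a. \<forall>y\<in>carrier_vec b. mat_form M x y = mat_form N x y) \<longleftrightarrow> M = N"
proof
  assume *: "\<forall>x\<in>carrier_vec a. \<forall>y\<in>carrier_vec b. mat_form M x y = mat_form N x y"
  show "M = N"
    by (rule eq_matI) (use M N * in \<open>auto simp flip: mat_form_unit[OF M] mat_form_unit[OF N]\<close>)
qed simp

lemma mat_form_mult:
  assumes S: "S \<in> carrier_mat c a" and T: "T \<in> carrier_mat d b" and M: "M \<in> carrier_mat c d"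
    and x: "x \<in> carrier_vec a" and y: "y \<in> carrier_vec b"
  shows "mat_form M (S *\<^sub>v x) (T *\<^sub>v y) = mat_form (S\<^sup>T * M * T) x y"
proof -
  have v: "M *\<^sub>v (T *\<^sub>v y) \<in> carrier_vec c" using M T y by auto
  have "(S\<^sup>T * M * T) *\<^sub>v y = S\<^sup>T *\<^sub>v (M *\<^sub>v (T *\<^sub>v y))"
  proof -
    have "S\<^sup>T * M * T *\<^sub>v y = S\<^sup>T * M *\<^sub>v (T *\<^sub>v y)"
      by (rule assoc_mult_mat_vec[of _ a d]) (use S T M y in auto)
    also have "\<dots> = S\<^sup>T *\<^sub>v (M *\<^sub>v (T *\<^sub>v y))"
      by (rule assoc_mult_mat_vec[of _ a c]) (use S T M y in auto)
    finally show ?thesis .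
  qed
  moreover have "x \<bullet> (S\<^sup>T *\<^sub>v (M *\<^sub>v (T *\<^sub>v y))) = (S *\<^sub>v x) \<bullet> (M *\<^sub>v (T *\<^sub>v y))"
  proof -
    let ?v = "M *\<^sub>v (T *\<^sub>v y)"
    have "x \<bullet> (S\<^sup>T *\<^sub>v ?v) = (S\<^sup>T *\<^sub>v ?v) \<bullet> x"
      by (rule comm_scalar_prod[of _ a]) (use S x v in auto)
    also have "\<dots> = ?v \<bullet> (S *\<^sub>v x)" by (rule transpose_vec_mult_scalar[OF S x v])
    also have "\<dots> = (S *\<^sub>v x) \<bullet> ?v"
      by (rule comm_scalar_prod[of _ c]) (use S x v in auto)
    finally show ?thesis .
  qed
  ultimately show ?thesis by (simp add: mat_form_def)
qed

lemma scalar_prod_in_dual_vecs: "v \<in> carrier_vec m \<Longrightarrow> (\<lambda>x. v \<bullet> x) \<in> dual_vecs m"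
  by (auto simp: dual_vecs_def scalar_prod_add_distrib[of _ m])

lemma dual_coords_scalar_prod: "v \<in> carrier_vec m \<Longrightarrow> dual_coords m (\<lambda>x. v \<bullet> x) = v"
  by (auto simp: dual_coords_def)

lemma dual_vecs_sum:
  assumes xi: "\<xi> \<in> dual_vecs m" and x: "x \<in> carrier_vec m"
  shows "\<xi> x = dual_coords m \<xi> \<bullet> x"
proof -
  define p where "p r = vec m (\<lambda>k. if k < r then x $ k else 0)" for r
  have p: "p r \<in> carrier_vec m" for r by (simp add: p_def)
  have "r \<le> m \<Longrightarrow> \<xi> (p r) = (\<Sum>k<r. \<xi> (unit_vec m k) * x $ k)" for r
  proof (induction r)
    case 0
    have "p 0 = 0 \<cdot>\<^sub>v x" using x by (auto simp: p_def)
    thus ?case using xi x by (auto simp: dual_vecs_def)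
  next
    case (Suc r)
    have "p (Suc r) = p r + x $ r \<cdot>\<^sub>v unit_vec m r"
      by (rule eq_vecI) (use Suc.prems in \<open>auto simp: p_def unit_vec_def less_Suc_eq\<close>)
    hence "\<xi> (p (Suc r)) = \<xi> (p r) + x $ r * \<xi> (unit_vec m r)"
      using xi p[of r] by (simp add: dual_vecs_def)
    thus ?case using Suc by simp
  qed
  moreover have "p m = x" using x by (auto simp: p_def)
  ultimately show ?thesis
    using x by (auto simp: dual_coords_def scalar_prod_def lessThan_atLeast0)
qed

lemma dual_coords_dual_map:
  assumes S: "S \<in> carrier_mat m m" and xi: "\<xi> \<in> dual_vecs m"
  shows "dual_coords m (dual_map (\<lambda>x. S *\<^sub>v x) \<xi>) = S\<^sup>T *\<^sub>v dual_coords m \<xi>"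
proof (rule eq_vecI)
  fix k assume "k < dim_vec (S\<^sup>T *\<^sub>v dual_coords m \<xi>)"
  hence k: "k < m" using S by simp
  have d: "dual_coords m \<xi> \<in> carrier_vec m" by (simp add: dual_coords_def)
  have "S *\<^sub>v unit_vec m k = col S k"
    using S k by (intro eq_vecI) auto
  hence "dual_coords m (dual_map (\<lambda>x. S *\<^sub>v x) \<xi>) $ k = \<xi> (col S k)"
    using k by (simp add: dual_coords_def dual_map_def)
  also have "\<dots> = dual_coords m \<xi> \<bullet> col S k"
    using dual_vecs_sum[OF xi] S k by auto
  also have "\<dots> = col S k \<bullet> dual_coords m \<xi>"
    using d S k by (intro comm_scalar_prod[of _ m]) auto
  finally show "dual_coords m (dual_map (\<lambda>x. S *\<^sub>v x) \<xi>) $ k = (S\<^sup>T *\<^sub>v dual_coords m \<xi>) $ k"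
    using S k by simp
qed (use S in \<open>simp add: dual_coords_def\<close>)

lemma mult_mat_vec_eq_iff:
  assumes M: "M \<in> carrier_mat a b" and N: "N \<in> carrier_mat a b"
  shows "(\<forall>x\<in>carrier_vec b. M *\<^sub>v x = (N *\<^sub>v x :: complex vec)) \<longleftrightarrow> M = N"
proof
  assume "\<forall>x\<in>carrier_vec b. M *\<^sub>v x = N *\<^sub>v x"
  thus "M = N" using mat_form_eq_iff[OF M N] by (auto simp: mat_form_def)
qed simp

lemma edge_compat_mat_iff:
  assumes S: "S i \<in> carrier_mat (n i) (n i)" "S j \<in> carrier_mat (n j) (n j)"
    and M: "M \<in> carrier_mat (n j) (n i)" and N: "N \<in> carrier_mat (n j) (n i)"
  shows "edge_compat n (\<lambda>i x. S i *\<^sub>v x) (Undirected i j) M N \<longleftrightarrow> M = (S j)\<^sup>T * N * S i"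
    and "edge_compat n (\<lambda>i x. S i *\<^sub>v x) (Directed i j) M N \<longleftrightarrow> S j * M = N * S i"
    and "edge_compat n (\<lambda>i x. S i *\<^sub>v x) (Bidirected i j) M N \<longleftrightarrow> S j * M * (S i)\<^sup>T = N"
proof -
  have "(S j)\<^sup>T * N * S i \<in> carrier_mat (n j) (n i)" using S N by auto
  from mat_form_eq_iff[OF M this]
  show "edge_compat n (\<lambda>i x. S i *\<^sub>v x) (Undirected i j) M N \<longleftrightarrow> M = (S j)\<^sup>T * N * S i"
    using S N by (simp add: mat_form_mult)
next
  have "S j * M \<in> carrier_mat (n j) (n i)" "N * S i \<in> carrier_mat (n j) (n i)" using S M N by auto
  from mult_mat_vec_eq_iff[OF this]
  show "edge_compat n (\<lambda>i x. S i *\<^sub>v x) (Directed i j) M N \<longleftrightarrow> S j * M = N * S i"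
    using S M N by (simp add: assoc_mult_mat_vec[of _ "n j" "n j" _ "n i"]
        assoc_mult_mat_vec[of _ "n j" "n i" _ "n i"])
next
  have c: "S j * M * (S i)\<^sup>T \<in> carrier_mat (n j) (n i)" using S M by auto
  have form: "mat_dual_form M (dual_map (\<lambda>x. S j *\<^sub>v x) \<xi>) (dual_map (\<lambda>x. S i *\<^sub>v x) \<eta>)
      = mat_form (S j * M * (S i)\<^sup>T) (dual_coords (n j) \<xi>) (dual_coords (n i) \<eta>)"
    if "\<xi> \<in> dual_vecs (n j)" "\<eta> \<in> dual_vecs (n i)" for \<xi> \<eta>
    using that S M mat_form_mult[of "(S j)\<^sup>T" "n j" "n j" "(S i)\<^sup>T" "n i" "n i" M
        "dual_coords (n j) \<xi>" "dual_coords (n i) \<eta>"]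
    by (simp add: mat_dual_form_def dual_coords_dual_map) (simp add: dual_coords_def)
  show "edge_compat n (\<lambda>i x. S i *\<^sub>v x) (Bidirected i j) M N \<longleftrightarrow> S j * M * (S i)\<^sup>T = N"
  proof
    assume *: "edge_compat n (\<lambda>i x. S i *\<^sub>v x) (Bidirected i j) M N"
    have "mat_form (S j * M * (S i)\<^sup>T) x y = mat_form N x y"
      if xy: "x \<in> carrier_vec (n j)" "y \<in> carrier_vec (n i)" for x y
      using form[of "\<lambda>z. x \<bullet> z" "\<lambda>z. y \<bullet> z"] * xy N
        scalar_prod_in_dual_vecs[OF xy(1)] scalar_prod_in_dual_vecs[OF xy(2)]
      by (simp add: dual_coords_scalar_prod mat_dual_form_def)
    thus "S j * M * (S i)\<^sup>T = N" using mat_form_eq_iff[OF c N] by blast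
  next
    assume "S j * M * (S i)\<^sup>T = N"
    thus "edge_compat n (\<lambda>i x. S i *\<^sub>v x) (Bidirected i j) M N"
      using form N by (auto simp: mat_dual_form_def)
  qed
qed

lemma bij_mult_mat_vec_iff:
  assumes S: "(S :: complex mat) \<in> carrier_mat m m"
  shows "bij_betw (\<lambda>x. S *\<^sub>v x) (carrier_vec m) (carrier_vec m) \<longleftrightarrow> invertible_mat S"
proof
  assume *: "bij_betw (\<lambda>x. S *\<^sub>v x) (carrier_vec m) (carrier_vec m)"
  have "\<exists>v. v \<in> carrier_vec m \<and> S *\<^sub>v v = unit_vec m k" for k
    using bij_betw_imp_surj_on[OF *] by (metis imageE unit_vec_carrier)
  then obtain v where v: "\<And>k. v k \<in> carrier_vec m" "\<And>k. S *\<^sub>v v k = unit_vec m k" by metis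
  define T where "T = mat m m (\<lambda>(l, k). v k $ l)"
  have T: "T \<in> carrier_mat m m" by (simp add: T_def)
  have col: "col T k = v k" if "k < m" for k
    using v(1)[of k] that by (intro eq_vecI) (auto simp: T_def)
  have "(S * T) $$ (l, k) = 1\<^sub>m m $$ (l, k)" if "l < m" "k < m" for l k
  proof -
    have "(S * T) $$ (l, k) = (S *\<^sub>v v k) $ l" using S T that by (simp add: col)
    thus ?thesis using v(2)[of k] that by auto
  qed
  hence "S * T = 1\<^sub>m m" using S T by (intro eq_matI) auto
  moreover from this have "T * S = 1\<^sub>m m" using mat_mult_left_right_inverse[OF S T] by blast
  ultimately show "invertible_mat S"
    using S T by (auto simp: invertible_mat_def inverts_mat_def)
next
  assume "invertible_mat S"
  then obtain T where T: "S * T = 1\<^sub>m m" "T * S = 1\<^sub>m (dim_row T)"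
    using S by (auto simp: invertible_mat_def inverts_mat_def)
  have cT: "T \<in> carrier_mat m m"
    using arg_cong[OF T(1), of dim_col] arg_cong[OF T(2), of dim_col] S by auto
  show "bij_betw (\<lambda>x. S *\<^sub>v x) (carrier_vec m) (carrier_vec m)"
  proof (rule bij_betwI)
    show "T *\<^sub>v (S *\<^sub>v x) = x" if "x \<in> carrier_vec m" for x
      using T(2) S cT that by (metis assoc_mult_mat_vec carrier_matD(1) one_mult_mat_vec)
    show "S *\<^sub>v (T *\<^sub>v x) = x" if "x \<in> carrier_vec m" for x
      using T(1) S cT that by (metis assoc_mult_mat_vec one_mult_mat_vec)
  qed (use S cT in auto)
qed

text \<open>For a directed edge, \<open>S j * M = N * S i\<close> is \<open>M = (S j)\<^sup>-\<^sup>1 * N * S i\<close>.\<close>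

theorem mat_isomorphism_iff:
  assumes G: "bidirected_graph G" and A: "matrix_rep G n A" and B: "matrix_rep G n B"
  shows "mat_isomorphism G n A B S \<longleftrightarrow>
    (\<forall>i\<in>{1..vertex_count G}. S i \<in> carrier_mat (n i) (n i) \<and> invertible_mat (S i)) \<and>
    (\<forall>e\<in>edge_set G. case ends_of G e of
        Undirected i j \<Rightarrow> A e = (S j)\<^sup>T * B e * S i
      | Directed i j \<Rightarrow> S j * A e = B e * S i
      | Bidirected i j \<Rightarrow> S j * A e * (S i)\<^sup>T = B e)"
proof (cases "\<forall>i\<in>{1..vertex_count G}. S i \<in> carrier_mat (n i) (n i)")
  case S: True
  have lin: "linear_on_vec (n i) (n i) (\<lambda>x. S i *\<^sub>v x)" if "i \<in> {1..vertex_count G}" for i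
  proof -
    have "S i \<in> carrier_mat (n i) (n i)" using S that by blast
    thus ?thesis by (auto simp: linear_on_vec_def mult_add_distrib_mat_vec[of _ _ "n i"] mult_mat_vec[of _ _ "n i"])
  qed
  have "edge_compat n (\<lambda>i x. S i *\<^sub>v x) (ends_of G e) (A e) (B e) \<longleftrightarrow>
    (case ends_of G e of
        Undirected i j \<Rightarrow> A e = (S j)\<^sup>T * B e * S i
      | Directed i j \<Rightarrow> S j * A e = B e * S i
      | Bidirected i j \<Rightarrow> S j * A e * (S i)\<^sup>T = B e)" if e: "e \<in> edge_set G" for e
  proof -
    have AB: "A e \<in> carrier_mat (n (edge_tgt (ends_of G e))) (n (edge_src (ends_of G e)))"
      "B e \<in> carrier_mat (n (edge_tgt (ends_of G e))) (n (edge_src (ends_of G e)))"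
      and wf: "wf_ends (vertex_count G) (ends_of G e)"
      using G A B e by (auto simp: bidirected_graph_def matrix_rep_def)
    show ?thesis
    proof (cases "ends_of G e")
      case (Undirected i j)
      with AB wf S edge_compat_mat_iff(1)[of S i n j "A e" "B e"] show ?thesis by simp
    next
      case (Directed i j)
      with AB wf S edge_compat_mat_iff(2)[of S i n j "A e" "B e"] show ?thesis by simp
    next
      case (Bidirected i j)
      with AB wf S edge_compat_mat_iff(3)[of S i n j "A e" "B e"] show ?thesis by simp
    qed
  qed
  with S lin show ?thesis
    by (simp add: mat_isomorphism_def rep_isomorphism_def bij_mult_mat_vec_iff)
qed (auto simp: mat_isomorphism_def)

end

theory Submission
  imports Defs "HOL-Analysis.L2_Norm" "HOL-Library.Function_Algebras"
begin

text \<open>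
  The equations for an isomorphism \<open>S\<close> from \<open>B\<close> to \<open>A\<close> are linear in \<open>S\<close> at the directed edges and
  quadratic at the others. They become linear everywhere when each vertex \<open>i\<close> is doubled: besides
  \<open>S i\<close> one takes an independent unknown \<open>R i\<close> in the place of the inverse transpose of \<open>S i\<close>.
  An undirected edge then asks for \<open>R j * B = A * S i\<close>, a bidirected edge for \<open>S j * B = A * R i\<close>,
  and each edge also gives the transposed equation with the two roles exchanged. The solutions
  form a space \<open>Hom(B, A)\<close> of morphisms of doubled representations (\<open>doubled_hom\<close>), with the identity
  in \<open>Hom(A, A)\<close>.

  An isomorphism between \<open>B\<close> and \<open>A\<close> yields, by composition, a linear bijection between \<open>Hom(A, A)\<close>
  and \<open>Hom(B, A)\<close>. So along the isomorphism class of \<open>A\<close> these kernels of linear systems have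
  constant dimension, and kernels of constant dimension depend in a Lipschitz way on the coefficients
  (\<open>kernel_perturbation\<close>). Hence \<open>Hom(B, A)\<close> has an element \<open>(S, R)\<close> at distance
  \<open>O(norm (B - A))\<close> from the identity (\<open>doubled_hom_near_id\<close>). This is where the hypothesis that \<open>B\<close> is
  isomorphic to \<open>A\<close> enters.

  It remains to turn \<open>(S, R)\<close> into a pair with \<open>R i\<close> equal to the inverse transpose of \<open>S i\<close>
  (\<open>doubled_hom_imp_near_isomorphism\<close>). The pair of inverse transposes \<open>(R\<^sup>-\<^sup>T, S\<^sup>-\<^sup>T)\<close> also
  solves the equations, so
  \<open>g i = S i * (R i)\<^sup>T\<close>, together with its transpose, is an endomorphism of the doubled \<open>A\<close> that is close
  to the identity. Its square root \<open>h i\<close> near the identity is a limit of polynomials in \<open>g i\<close>, with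
  coefficients that depend on neither the vertex nor the edge, and so it is such an endomorphism as
  well. Multiplying \<open>(S, R)\<close> on the left by the inverse of this endomorphism gives a solution
  \<open>(h\<^sup>-\<^sup>1 S, h\<^sup>-\<^sup>T R)\<close>, and it is self-dual because
  \<open>h\<^sup>-\<^sup>1 S (h\<^sup>-\<^sup>T R)\<^sup>T = h\<^sup>-\<^sup>1 g h\<^sup>-\<^sup>1 = 1\<close>. Therefore \<open>h\<^sup>-\<^sup>1 S\<close> is an isomorphism from \<open>B\<close> to \<open>A\<close>.
\<close>

section \<open>Entrywise norm of matrices\<close>

text \<open>The sum of the moduli is equivalent to the Frobenius norm in each fixed size, and it makes the
  estimates below shorter. The constants in the final bound absorb the difference.\<close>

definition entry_norm :: "complex mat \<Rightarrow> real" where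
  "entry_norm M = (\<Sum>i<dim_row M. \<Sum>j<dim_col M. cmod (M $$ (i, j)))"

lemma entry_norm_carrier:
  "M \<in> carrier_mat r c \<Longrightarrow> entry_norm M = (\<Sum>i<r. \<Sum>j<c. cmod (M $$ (i, j)))"
  by (auto simp: entry_norm_def)

lemma entry_norm_nonneg: "0 \<le> entry_norm M"
  by (auto simp: entry_norm_def intro!: sum_nonneg)

lemma cmod_entry_le_entry_norm:
  assumes "M \<in> carrier_mat r c" "i < r" "j < c"
  shows "cmod (M $$ (i, j)) \<le> entry_norm M"
proof -
  have "cmod (M $$ (i, j)) \<le> (\<Sum>j<c. cmod (M $$ (i, j)))"
    by (rule member_le_sum) (use assms in auto)
  also have "\<dots> \<le> (\<Sum>i<r. \<Sum>j<c. cmod (M $$ (i, j)))"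
    by (rule member_le_sum[of i _ "\<lambda>i. \<Sum>j<c. cmod (M $$ (i, j))"]) (use assms in \<open>auto intro: sum_nonneg\<close>)
  finally show ?thesis using assms by (simp add: entry_norm_carrier)
qed

lemma entry_norm_add_le:
  assumes "M \<in> carrier_mat r c" "N \<in> carrier_mat r c"
  shows "entry_norm (M + N) \<le> entry_norm M + entry_norm N"
  using assms
  by (simp add: entry_norm_carrier[of _ r c] sum.distrib[symmetric] add_carrier_mat)
    (intro sum_mono norm_triangle_ineq)

lemma entry_norm_diff_le:
  assumes "M \<in> carrier_mat r c" "N \<in> carrier_mat r c"
  shows "entry_norm (M - N) \<le> entry_norm M + entry_norm N"
  using assms
  by (simp add: entry_norm_carrier[of _ r c] sum.distrib[symmetric] minus_carrier_mat)
    (intro sum_mono norm_triangle_ineq4)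

lemma entry_norm_smult: "entry_norm (a \<cdot>\<^sub>m M) = cmod a * entry_norm M"
  by (simp add: entry_norm_def norm_mult sum_distrib_left)

lemma entry_norm_transpose: "entry_norm (M\<^sup>T) = entry_norm M"
  unfolding entry_norm_def by (subst sum.swap) simp

lemma entry_norm_mult_le:
  assumes M: "M \<in> carrier_mat a b" and N: "N \<in> carrier_mat b c"
  shows "entry_norm (M * N) \<le> entry_norm M * entry_norm N"
proof -
  have "entry_norm (M * N) = (\<Sum>i<a. \<Sum>j<c. cmod (\<Sum>k<b. M $$ (i, k) * N $$ (k, j)))"
    using M N by (simp add: entry_norm_carrier[of _ a c] scalar_prod_def lessThan_atLeast0)
  also have "\<dots> \<le> (\<Sum>i<a. \<Sum>j<c. \<Sum>k<b. cmod (M $$ (i, k)) * cmod (N $$ (k, j)))"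
    by (intro sum_mono order.trans[OF norm_sum]) (simp add: norm_mult)
  also have "\<dots> = (\<Sum>i<a. \<Sum>k<b. cmod (M $$ (i, k)) * (\<Sum>j<c. cmod (N $$ (k, j))))"
    unfolding sum_distrib_left by (intro sum.cong refl sum.swap)
  also have "\<dots> \<le> (\<Sum>i<a. \<Sum>k<b. cmod (M $$ (i, k)) * entry_norm N)"
  proof (intro sum_mono mult_left_mono)
    fix k assume "k \<in> {..<b}"
    thus "(\<Sum>j<c. cmod (N $$ (k, j))) \<le> entry_norm N"
      using N member_le_sum[of k "{..<b}" "\<lambda>k. \<Sum>j<c. cmod (N $$ (k, j))"]
      by (auto simp: entry_norm_carrier sum_nonneg)
  qed auto
  also have "\<dots> = entry_norm M * entry_norm N"
    using M by (simp add: entry_norm_carrier sum_distrib_right)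
  finally show ?thesis .
qed

lemma frob_norm_le_entry_norm: "frob_norm M \<le> entry_norm M"
proof -
  let ?I = "{..<dim_row M} \<times> {..<dim_col M}"
  have "frob_norm M = L2_set (\<lambda>p. cmod (M $$ p)) ?I"
    by (simp add: frob_norm_def L2_set_def sum.cartesian_product)
  also have "\<dots> \<le> (\<Sum>p\<in>?I. cmod (M $$ p))"
    by (rule L2_set_le_sum) auto
  also have "\<dots> = entry_norm M"
    by (simp add: entry_norm_def sum.cartesian_product)
  finally show ?thesis .
qed

lemma frob_norm_nonneg: "0 \<le> frob_norm M"
  by (auto simp: frob_norm_def intro!: sum_nonneg)

lemma entry_norm_le_frob_norm: "entry_norm M \<le> real (dim_row M * dim_col M) * frob_norm M"
proof -
  let ?I = "{..<dim_row M} \<times> {..<dim_col M}"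
  have eq: "frob_norm M = L2_set (\<lambda>p. cmod (M $$ p)) ?I"
    by (simp add: frob_norm_def L2_set_def sum.cartesian_product)
  have "entry_norm M = (\<Sum>p\<in>?I. cmod (M $$ p))"
    by (simp add: entry_norm_def sum.cartesian_product)
  also have "\<dots> \<le> (\<Sum>p\<in>?I. frob_norm M)"
    unfolding eq by (intro sum_mono member_le_L2_set) auto
  finally show ?thesis by simp
qed

text \<open>A vector \<open>v\<close> with \<open>M v = 0\<close> satisfies \<open>(M - 1) v = - v\<close>, which a contraction allows only for
  \<open>v = 0\<close>. The vector is handled as a matrix with one column so that the norm estimate for products applies.\<close>

lemma invertible_near_one:
  assumes M: "M \<in> carrier_mat m m" and small: "entry_norm (M - 1\<^sub>m m) < 1"
  obtains M' where "M' \<in> carrier_mat m m" "M * M' = 1\<^sub>m m" "M' * M = 1\<^sub>m m"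
proof -
  have "det M \<noteq> 0"
  proof
    assume "det M = 0"
    then obtain v where v: "v \<in> carrier_vec m" "v \<noteq> 0\<^sub>v m" "M *\<^sub>v v = 0\<^sub>v m"
      using det_0_iff_vec_prod_zero[OF M] by auto
    define V where "V = mat m 1 (\<lambda>(i, j). v $ i)"
    have V: "V \<in> carrier_mat m 1" by (simp add: V_def)
    have "col V 0 = v" using v by (intro eq_vecI) (auto simp: V_def)
    hence "M * V = 0\<^sub>m m 1"
      using M V v(3) by (intro eq_matI) (auto simp: index_mult_mat_vec[symmetric] simp del: index_mult_mat_vec)
    hence "(M - 1\<^sub>m m) * V = - V"
      using M V by (intro eq_matI) (auto simp: minus_mult_distrib_mat[of _ m m])
    hence "entry_norm V = entry_norm ((M - 1\<^sub>m m) * V)"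
      using V by (simp add: entry_norm_def)
    also have "\<dots> \<le> entry_norm (M - 1\<^sub>m m) * entry_norm V"
      using M V by (intro entry_norm_mult_le[of _ m m]) auto
    finally have "entry_norm V \<le> 0"
      using small by (smt (verit) entry_norm_nonneg mult_less_cancel_right2)
    moreover have "cmod (V $$ (i, 0)) \<le> entry_norm V" if "i < m" for i
      using cmod_entry_le_entry_norm[OF V that, of 0] by simp
    ultimately have "cmod (V $$ (i, 0)) \<le> 0" if "i < m" for i
      using that by (meson order.trans)
    hence "v = 0\<^sub>v m" using v by (intro eq_vecI) (auto simp: V_def)
    with v show False by simp
  qed
  then obtain M' where M': "M' \<in> carrier_mat m m" "M * M' = 1\<^sub>m m" "M' * M = 1\<^sub>m m"
    using det_non_zero_imp_unit[OF M, of "()"] by (auto simp: Units_def ring_mat_def)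
  thus ?thesis using that by blast
qed

lemma entry_norm_minus_commute:
  assumes "M \<in> carrier_mat r c" "N \<in> carrier_mat r c"
  shows "entry_norm (M - N) = entry_norm (N - M)"
  using assms
  by (simp add: entry_norm_carrier[of _ r c] minus_carrier_mat norm_minus_commute)

lemma diff_mat_eq_0_iff:
  assumes "(M :: complex mat) \<in> carrier_mat r c" "N \<in> carrier_mat r c"
  shows "M - N = 0\<^sub>m r c \<longleftrightarrow> M = N"
proof
  assume *: "M - N = 0\<^sub>m r c"
  have "M $$ (i, j) = N $$ (i, j)" if "i < r" "j < c" for i j
    using arg_cong[OF *, of "\<lambda>M. M $$ (i, j)"] that assms by simp
  thus "M = N" using assms by (intro eq_matI) auto
qed (use assms in auto)

section \<open>Square roots near the identity matrix\<close>

text \<open>All terms are required to have the shape of the limit, since the entries of a matrix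
  outside its shape are meaningless.\<close>

definition mat_tendsto :: "(nat \<Rightarrow> complex mat) \<Rightarrow> complex mat \<Rightarrow> bool" where
  "mat_tendsto F L \<longleftrightarrow>
     (\<forall>k. F k \<in> carrier_mat (dim_row L) (dim_col L)) \<and>
     (\<forall>i<dim_row L. \<forall>j<dim_col L. (\<lambda>k. F k $$ (i, j)) \<longlonglongrightarrow> L $$ (i, j))"

lemma mat_tendsto_unique: "mat_tendsto F L \<Longrightarrow> mat_tendsto F L' \<Longrightarrow> L = L'"
  unfolding mat_tendsto_def
  by (intro eq_matI; metis LIMSEQ_unique carrier_matD)

lemma mat_tendsto_const: "mat_tendsto (\<lambda>k. M) M"
  by (auto simp: mat_tendsto_def)

lemma mat_tendsto_Suc: "mat_tendsto F L \<Longrightarrow> mat_tendsto (\<lambda>k. F (Suc k)) L"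
  using LIMSEQ_Suc by (fastforce simp: mat_tendsto_def)

lemma mat_tendsto_mult:
  assumes "mat_tendsto F L" "mat_tendsto F' L'" "dim_col L = dim_row L'"
  shows "mat_tendsto (\<lambda>k. F k * F' k) (L * L')"
proof -
  have c: "F k \<in> carrier_mat (dim_row L) (dim_col L)" "F' k \<in> carrier_mat (dim_row L') (dim_col L')" for k
    using assms by (auto simp: mat_tendsto_def)
  have "(\<lambda>k. (F k * F' k) $$ (i, j)) \<longlonglongrightarrow> (L * L') $$ (i, j)"
    if ij: "i < dim_row L" "j < dim_col L'" for i j
  proof -
    have "(\<lambda>k. \<Sum>l = 0..<dim_row L'. F k $$ (i, l) * F' k $$ (l, j))
        \<longlonglongrightarrow> (\<Sum>l = 0..<dim_row L'. L $$ (i, l) * L' $$ (l, j))"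
      by (intro tendsto_sum tendsto_mult) (use assms ij in \<open>auto simp: mat_tendsto_def\<close>)
    moreover have "(F k * F' k) $$ (i, j) = (\<Sum>l = 0..<dim_row L'. F k $$ (i, l) * F' k $$ (l, j))" for k
      using c[of k] ij assms(3) by (simp add: scalar_prod_def)
    ultimately show ?thesis using ij assms(3) by (simp add: scalar_prod_def)
  qed
  moreover have "F k * F' k \<in> carrier_mat (dim_row L) (dim_col L')" for k
    using c[of k] by auto
  ultimately show ?thesis by (simp add: mat_tendsto_def)
qed

lemma mat_tendsto_diff:
  assumes "mat_tendsto F L" "mat_tendsto F' L'" "dim_row L = dim_row L'" "dim_col L = dim_col L'"
  shows "mat_tendsto (\<lambda>k. F k - F' k) (L - L')"
proof -
  have c: "F k \<in> carrier_mat (dim_row L') (dim_col L')" "F' k \<in> carrier_mat (dim_row L') (dim_col L')" for k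
    using assms by (auto simp: mat_tendsto_def)
  thus ?thesis using assms
    by (auto simp: mat_tendsto_def minus_carrier_mat carrier_matD[OF c(2)] intro!: tendsto_diff)
qed

lemma mat_tendsto_smult: "mat_tendsto F L \<Longrightarrow> mat_tendsto (\<lambda>k. a \<cdot>\<^sub>m F k) (a \<cdot>\<^sub>m L)"
proof -
  assume F: "mat_tendsto F L"
  hence c: "F k \<in> carrier_mat (dim_row L) (dim_col L)" for k by (auto simp: mat_tendsto_def)
  show ?thesis using F carrier_matD[OF c]
    by (auto simp: mat_tendsto_def intro!: tendsto_mult)
qed

lemma entry_norm_limit_le:
  assumes F: "mat_tendsto F L" and bd: "\<And>k. entry_norm (F k) \<le> b"
  shows "entry_norm L \<le> b"
proof -
  have c: "F k \<in> carrier_mat (dim_row L) (dim_col L)" for k using F by (auto simp: mat_tendsto_def)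
  have "(\<lambda>k. entry_norm (F k)) \<longlonglongrightarrow> entry_norm L"
    using F unfolding entry_norm_carrier[OF c] unfolding entry_norm_def mat_tendsto_def
    by (intro tendsto_sum tendsto_norm) auto
  thus ?thesis using bd by (intro LIMSEQ_le_const2) auto
qed

text \<open>The equation \<open>(1 + u)\<^sup>2 = 1 + N\<close> is equivalent to \<open>u = (N - u\<^sup>2) / 2\<close>. For small \<open>N\<close> the right-hand
  side is a contraction, and iterating it from \<open>0\<close> produces polynomials in \<open>N\<close>. This is why the
  square root inherits the commutation properties of \<open>N\<close>.\<close>

primrec sqrt_iter :: "complex mat \<Rightarrow> nat \<Rightarrow> complex mat" where
  "sqrt_iter N 0 = 0\<^sub>m (dim_row N) (dim_row N)"
| "sqrt_iter N (Suc k) = (1 / 2) \<cdot>\<^sub>m (N - sqrt_iter N k * sqrt_iter N k)"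

text \<open>The increment of the square root: \<open>1 + sqrt_incr N\<close> is the square root of \<open>1 + N\<close> near \<open>1\<close>.\<close>

definition sqrt_incr :: "complex mat \<Rightarrow> complex mat" where
  "sqrt_incr N = mat (dim_row N) (dim_row N) (\<lambda>p. lim (\<lambda>k. sqrt_iter N k $$ p))"

lemma sqrt_iter_carrier: "N \<in> carrier_mat m m \<Longrightarrow> sqrt_iter N k \<in> carrier_mat m m"
  by (induction k) auto

lemma entry_norm_half: "entry_norm ((1 / 2) \<cdot>\<^sub>m M) = entry_norm M / 2"
  by (simp add: entry_norm_smult norm_divide)

lemma entry_norm_sqrt_iter_le:
  assumes N: "N \<in> carrier_mat m m" and small: "entry_norm N \<le> 1 / 4"
  shows "entry_norm (sqrt_iter N k) \<le> entry_norm N"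
proof (induction k)
  case 0
  thus ?case using entry_norm_nonneg[of N] by (simp add: entry_norm_def)
next
  case (Suc k)
  let ?U = "sqrt_iter N k" and ?\<nu> = "entry_norm N"
  note U = sqrt_iter_carrier[OF N, of k]
  have "entry_norm (N - ?U * ?U) \<le> ?\<nu> + entry_norm (?U * ?U)"
    by (rule entry_norm_diff_le[OF N]) (use U in auto)
  also have "entry_norm (?U * ?U) \<le> entry_norm ?U * entry_norm ?U"
    by (rule entry_norm_mult_le[OF U U])
  also have "\<dots> \<le> ?\<nu> * 1"
    by (intro mult_mono) (use Suc small entry_norm_nonneg in \<open>auto intro: order.trans\<close>)
  finally show ?case unfolding sqrt_iter.simps entry_norm_half by simp
qed

text \<open>The difference \<open>V\<^sup>2 - U\<^sup>2 = V (V - U) + (V - U) U\<close> of two squares is at most half as large as \<open>V - U\<close>,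
  because the iterates stay in the ball of radius \<open>1 / 4\<close>. The factor \<open>1 / 2\<close> in the iteration makes it a quarter.\<close>

lemma sqrt_iter_contracts:
  assumes N: "N \<in> carrier_mat m m" and small: "entry_norm N \<le> 1 / 4"
  shows "entry_norm (sqrt_iter N (Suc k) - sqrt_iter N k) \<le> (1 / 4) ^ k * entry_norm N"
proof (induction k)
  case 0
  have "sqrt_iter N (Suc 0) - sqrt_iter N 0 = (1 / 2) \<cdot>\<^sub>m N"
    using N by (intro eq_matI) auto
  thus ?case using entry_norm_nonneg[of N] by (simp only: entry_norm_half) simp
next
  case (Suc k)
  define U V where "U = sqrt_iter N k" and "V = sqrt_iter N (Suc k)"
  have UV: "U \<in> carrier_mat m m" "V \<in> carrier_mat m m"
    unfolding U_def V_def by (rule sqrt_iter_carrier[OF N])+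
  have le: "entry_norm U \<le> 1 / 4" "entry_norm V \<le> 1 / 4"
    unfolding U_def V_def using entry_norm_sqrt_iter_le[OF N small] small by (meson order.trans)+
  have V2: "sqrt_iter N (Suc (Suc k)) = (1 / 2) \<cdot>\<^sub>m (N - V * V)" by (simp add: V_def)
  have V1: "V = (1 / 2) \<cdot>\<^sub>m (N - U * U)" by (simp add: V_def U_def)
  have "sqrt_iter N (Suc (Suc k)) - V = (1 / 2) \<cdot>\<^sub>m (- (V * V - U * U))"
    unfolding V2 using N UV by (subst (3) V1, intro eq_matI) (auto simp: algebra_simps diff_divide_distrib)
  moreover have "V * V - U * U = V * (V - U) + (V - U) * U"
    using UV by (intro eq_matI)
      (auto simp: mult_minus_distrib_mat[of _ m m _ m] minus_mult_distrib_mat[of _ m m])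
  moreover have "entry_norm (V * (V - U) + (V - U) * U) \<le> entry_norm (V * (V - U)) + entry_norm ((V - U) * U)"
    using UV by (intro entry_norm_add_le[of _ m m]) auto
  moreover have "entry_norm (V * (V - U)) \<le> entry_norm V * entry_norm (V - U)"
    using UV by (intro entry_norm_mult_le[of _ m m]) auto
  moreover have "entry_norm ((V - U) * U) \<le> entry_norm (V - U) * entry_norm U"
    using UV by (intro entry_norm_mult_le[of _ m m]) auto
  moreover have "entry_norm V * entry_norm (V - U) \<le> 1 / 4 * entry_norm (V - U)"
    using le entry_norm_nonneg by (intro mult_right_mono) auto
  moreover have "entry_norm (V - U) * entry_norm U \<le> entry_norm (V - U) * (1 / 4)"
    using le entry_norm_nonneg by (intro mult_left_mono) auto
  moreover have "entry_norm (- M) = entry_norm M" for M by (simp add: entry_norm_def)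
  ultimately have "entry_norm (sqrt_iter N (Suc (Suc k)) - V) \<le> entry_norm (V - U) / 4"
    by (simp only: entry_norm_half)
  also have "\<dots> \<le> ((1 / 4) ^ k * entry_norm N) / 4"
    using Suc unfolding U_def V_def by linarith
  finally show ?case by (simp add: V_def)
qed

lemma sqrt_iter_tendsto:
  assumes N: "N \<in> carrier_mat m m" and small: "entry_norm N \<le> 1 / 4"
  shows "mat_tendsto (sqrt_iter N) (sqrt_incr N)"
proof -
  have "convergent (\<lambda>k. sqrt_iter N k $$ (i, j))" if ij: "i < m" "j < m" for i j
  proof -
    let ?a = "\<lambda>k. sqrt_iter N k $$ (i, j)"
    have step: "norm (?a (Suc k) - ?a k) \<le> (1 / 4) ^ k * entry_norm N" for k
    proof -
      have c: "sqrt_iter N (Suc k) \<in> carrier_mat m m" "sqrt_iter N k \<in> carrier_mat m m"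
        by (rule sqrt_iter_carrier[OF N])+
      hence "?a (Suc k) - ?a k = (sqrt_iter N (Suc k) - sqrt_iter N k) $$ (i, j)"
        using ij by (simp del: sqrt_iter.simps)
      also have "norm \<dots> \<le> entry_norm (sqrt_iter N (Suc k) - sqrt_iter N k)"
        using c ij by (intro cmod_entry_le_entry_norm[of _ m m]) (auto simp del: sqrt_iter.simps)
      finally show ?thesis using sqrt_iter_contracts[OF N small, of k] by linarith
    qed
    have "summable (\<lambda>k. (1 / 4) ^ k * entry_norm N)"
      by (intro summable_mult2 summable_geometric) simp
    hence "summable (\<lambda>k. ?a (Suc k) - ?a k)"
      by (rule summable_comparison_test'[where N = 0]) (rule step)
    hence "convergent (\<lambda>k. \<Sum>l<k. ?a (Suc l) - ?a l)"
      by (simp add: summable_iff_convergent)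
    hence "convergent (\<lambda>k. ?a k - ?a 0)" by (simp only: sum_lessThan_telescope[of ?a])
    thus ?thesis by (simp only: convergent_diff_const_right_iff)
  qed
  thus ?thesis using N sqrt_iter_carrier[OF N]
    by (auto simp: mat_tendsto_def sqrt_incr_def convergent_LIMSEQ_iff)
qed

lemma sqrt_incr_carrier: "N \<in> carrier_mat m m \<Longrightarrow> sqrt_incr N \<in> carrier_mat m m"
  by (auto simp: sqrt_incr_def)

lemma entry_norm_sqrt_incr_le:
  assumes "N \<in> carrier_mat m m" "entry_norm N \<le> 1 / 4"
  shows "entry_norm (sqrt_incr N) \<le> entry_norm N"
  using sqrt_iter_tendsto[OF assms] entry_norm_sqrt_iter_le[OF assms] by (rule entry_norm_limit_le)

lemma sqrt_incr_fixpoint: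
  assumes N: "N \<in> carrier_mat m m" and small: "entry_norm N \<le> 1 / 4"
  shows "sqrt_incr N = (1 / 2) \<cdot>\<^sub>m (N - sqrt_incr N * sqrt_incr N)"
proof (rule mat_tendsto_unique)
  note t = sqrt_iter_tendsto[OF N small] and c = sqrt_incr_carrier[OF N]
  show "mat_tendsto (\<lambda>k. sqrt_iter N (Suc k)) (sqrt_incr N)" by (rule mat_tendsto_Suc[OF t])
  show "mat_tendsto (\<lambda>k. sqrt_iter N (Suc k)) ((1 / 2) \<cdot>\<^sub>m (N - sqrt_incr N * sqrt_incr N))"
    unfolding sqrt_iter.simps
    by (intro mat_tendsto_smult mat_tendsto_diff mat_tendsto_mult mat_tendsto_const t) (use N c in auto)
qed

lemma sqrt_incr_square:
  assumes N: "N \<in> carrier_mat m m" and small: "entry_norm N \<le> 1 / 4"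
  shows "(1\<^sub>m m + sqrt_incr N) * (1\<^sub>m m + sqrt_incr N) = 1\<^sub>m m + N"
proof -
  define U where "U = sqrt_incr N"
  have U: "U \<in> carrier_mat m m" by (simp add: U_def sqrt_incr_carrier[OF N])
  have fp: "U = (1 / 2) \<cdot>\<^sub>m (N - U * U)" using sqrt_incr_fixpoint[OF N small] by (simp add: U_def)
  have e: "(1\<^sub>m m + U) * (1\<^sub>m m + U) = (1\<^sub>m m + U) + (U + U * U)"
    using U by (simp add: add_mult_distrib_mat[of _ m m] mult_add_distrib_mat[of _ m m _ m])
  show ?thesis unfolding U_def[symmetric] e
  proof (rule eq_matI)
    fix i j assume "i < dim_row (1\<^sub>m m + N)" "j < dim_col (1\<^sub>m m + N)"
    hence ij: "i < m" "j < m" using N by auto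
    have "U $$ (i, j) = ((1 / 2) \<cdot>\<^sub>m (N - U * U)) $$ (i, j)" using fp by simp
    hence "2 * U $$ (i, j) = N $$ (i, j) - (U * U) $$ (i, j)"
      using N U ij by (simp del: index_mult_mat(1) add: mult.commute[of _ 2])
    thus "((1\<^sub>m m + U) + (U + U * U)) $$ (i, j) = (1\<^sub>m m + N) $$ (i, j)"
      using N U ij by (simp del: index_mult_mat(1) add: algebra_simps)
  qed (use N U in auto)
qed

text \<open>The iterates are the same polynomials in \<open>N\<close> and in \<open>N'\<close>, even when the two matrices have
  different sizes. So whatever intertwines \<open>N\<close> with \<open>N'\<close> intertwines the iterates.\<close>

lemma sqrt_iter_intertwines:
  assumes C: "C \<in> carrier_mat a b" and N: "N \<in> carrier_mat b b" and N': "N' \<in> carrier_mat a a"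
    and eq: "C * N = N' * C"
  shows "C * sqrt_iter N k = sqrt_iter N' k * C"
proof (induction k)
  case 0
  thus ?case using C N N' by simp
next
  case (Suc k)
  let ?U = "sqrt_iter N k" and ?U' = "sqrt_iter N' k"
  note U = sqrt_iter_carrier[OF N, of k] and U' = sqrt_iter_carrier[OF N', of k]
  have "C * (?U * ?U) = (C * ?U) * ?U" using C U by simp
  also have "\<dots> = ?U' * (C * ?U)" using C U U' by (simp add: Suc)
  also have "\<dots> = (?U' * ?U') * C" using C U U' by (simp add: Suc)
  finally have sq: "C * (?U * ?U) = (?U' * ?U') * C" .
  have "C * sqrt_iter N (Suc k) = (1 / 2) \<cdot>\<^sub>m (C * (N - ?U * ?U))"
    unfolding sqrt_iter.simps
    by (rule mult_smult_distrib[OF C]) (use N U in auto)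
  also have "\<dots> = (1 / 2) \<cdot>\<^sub>m ((N' - ?U' * ?U') * C)"
    using C N N' U U' sq eq
    by (simp add: mult_minus_distrib_mat[of _ a b _ b] minus_mult_distrib_mat[of _ a a])
  also have "\<dots> = sqrt_iter N' (Suc k) * C"
    unfolding sqrt_iter.simps
    by (rule mult_smult_assoc_mat[symmetric, of _ a a]) (use C N' U' in auto)
  finally show ?case .
qed

lemma sqrt_incr_intertwines:
  assumes C: "C \<in> carrier_mat a b" and N: "N \<in> carrier_mat b b" and N': "N' \<in> carrier_mat a a"
    and eq: "C * N = N' * C" and small: "entry_norm N \<le> 1 / 4" "entry_norm N' \<le> 1 / 4"
  shows "C * sqrt_incr N = sqrt_incr N' * C"
proof (rule mat_tendsto_unique)
  show "mat_tendsto (\<lambda>k. C * sqrt_iter N k) (C * sqrt_incr N)"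
    by (intro mat_tendsto_mult mat_tendsto_const sqrt_iter_tendsto[OF N small(1)])
      (use C sqrt_incr_carrier[OF N] in auto)
  show "mat_tendsto (\<lambda>k. C * sqrt_iter N k) (sqrt_incr N' * C)"
    unfolding sqrt_iter_intertwines[OF C N N' eq]
    by (intro mat_tendsto_mult mat_tendsto_const sqrt_iter_tendsto[OF N' small(2)])
      (use C sqrt_incr_carrier[OF N'] in auto)
qed

lemma sqrt_iter_transpose: "N \<in> carrier_mat m m \<Longrightarrow> sqrt_iter (N\<^sup>T) k = (sqrt_iter N k)\<^sup>T"
proof (induction k)
  case (Suc k)
  have U: "sqrt_iter N k \<in> carrier_mat m m" using Suc.prems by (rule sqrt_iter_carrier)
  have "sqrt_iter (N\<^sup>T) k * sqrt_iter (N\<^sup>T) k = (sqrt_iter N k * sqrt_iter N k)\<^sup>T"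
    using Suc U by (simp add: transpose_mult[OF U U])
  thus ?case using Suc.prems U by (intro eq_matI) (auto simp del: index_mult_mat(1))
qed auto

lemma sqrt_incr_transpose:
  assumes N: "N \<in> carrier_mat m m"
  shows "sqrt_incr (N\<^sup>T) = (sqrt_incr N)\<^sup>T"
proof (rule eq_matI)
  fix i j assume "i < dim_row ((sqrt_incr N)\<^sup>T)" "j < dim_col ((sqrt_incr N)\<^sup>T)"
  hence ij: "i < m" "j < m" using N by (auto simp: sqrt_incr_def)
  have "sqrt_iter (N\<^sup>T) k $$ (i, j) = sqrt_iter N k $$ (j, i)" for k
    using sqrt_iter_carrier[OF N, of k] ij by (simp add: sqrt_iter_transpose[OF N])
  thus "sqrt_incr (N\<^sup>T) $$ (i, j) = (sqrt_incr N)\<^sup>T $$ (i, j)"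
    using N ij by (simp add: sqrt_incr_def)
qed (use N in \<open>auto simp: sqrt_incr_def\<close>)

section \<open>Perturbation of kernels of linear maps\<close>

text \<open>The ambient space may have infinite dimension, so the count takes place in \<open>W\<close>: the image of a basis of \<open>W\<close>
  is an independent set of the same size, so no vector of \<open>W\<close> can be added to it.\<close>

lemma injective_endomorphism_surj_on_finite_dim:
  fixes f :: "'a::ab_group_add \<Rightarrow> 'a"
  assumes lin: "Vector_Spaces.linear s s f"
    and W: "module.subspace s W" and F: "finite F" "W \<subseteq> module.span s F"
    and into: "f ` W \<subseteq> W" and inj: "inj_on f W"
  shows "f ` W = W"
proof -
  interpret f: Vector_Spaces.linear s s f by (rule lin)
  obtain B where B: "B \<subseteq> W" "f.vs1.independent B" "W \<subseteq> f.vs1.span B"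
    using f.vs1.maximal_independent_subset by blast
  have WB: "f.vs1.span B = W"
    using B f.vs1.span_minimal[OF B(1) W] by blast
  have finB: "finite B"
    using f.vs1.independent_span_bound[OF F(1) B(2)] B(1) F(2) by blast
  have ind: "f.vs1.independent (f ` B)"
    using f.independent_injective_image[of B] inj B(2) WB by simp
  have card: "card (f ` B) = card B"
    by (rule card_image) (rule inj_on_subset[OF inj B(1)])
  have "w \<in> f ` W" if w: "w \<in> W" for w
  proof (rule ccontr)
    assume "w \<notin> f ` W"
    hence nw: "w \<notin> f.vs1.span (f ` B)" by (simp add: f.span_image WB)
    hence "f.vs1.independent (insert w (f ` B))"
      using ind by (rule f.vs1.independent_insertI)
    moreover have "insert w (f ` B) \<subseteq> f.vs1.span B"
      using WB w into B(1) by auto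
    ultimately have "card (insert w (f ` B)) \<le> card B"
      using f.vs1.independent_span_bound[OF finB] by blast
    moreover have "w \<notin> f ` B" using nw f.vs1.span_superset by blast
    ultimately show False using finB card by simp
  qed
  thus ?thesis using into by blast
qed

definition fscale :: "complex \<Rightarrow> ('k \<Rightarrow> complex) \<Rightarrow> 'k \<Rightarrow> complex" where
  "fscale c x = (\<lambda>k. c * x k)"

text \<open>The functions supported on a finite set \<open>K\<close> are a model of the coordinate space of
  dimension \<open>card K\<close>. The index set is a term and not a type, as the dimensions of a representation require.\<close>

definition supported_on :: "'k set \<Rightarrow> ('k \<Rightarrow> complex) set" where
  "supported_on K = {x. \<forall>k. k \<notin> K \<longrightarrow> x k = 0}"

definition l1_norm :: "'k set \<Rightarrow> ('k \<Rightarrow> complex) \<Rightarrow> real" where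
  "l1_norm K x = (\<Sum>k\<in>K. cmod (x k))"

lemma vector_space_fscale: "vector_space fscale"
  by unfold_locales (auto simp: fscale_def fun_eq_iff algebra_simps)

lemma linearI_fscale:
  assumes "\<And>x y. f (x + y) = f x + f y" "\<And>c x. f (fscale c x) = fscale c (f x)"
  shows "Vector_Spaces.linear fscale fscale f"
  using assms by (simp add: Vector_Spaces.linear_iff vector_space_fscale)

lemma subspace_supported_on: "module.subspace fscale (supported_on K)"
proof -
  interpret vector_space fscale by (rule vector_space_fscale)
  show ?thesis by (auto intro!: subspaceI simp: supported_on_def fscale_def)
qed

lemma sum_fun_apply: "(\<Sum>a\<in>A. f a) k = (\<Sum>a\<in>A. f a k)"
  for f :: "'a \<Rightarrow> 'k \<Rightarrow> 'b::comm_monoid_add"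
  by (induction A rule: infinite_finite_induct) auto

lemma supported_on_expand:
  assumes "finite K" "x \<in> supported_on K"
  shows "x = (\<Sum>k\<in>K. fscale (x k) (\<lambda>k'. if k' = k then 1 else 0))"
  using assms
  by (auto simp: fun_eq_iff sum_fun_apply fscale_def supported_on_def if_distrib[of "times _"] cong: if_cong)

lemma supported_on_le_span:
  assumes "finite K"
  shows "supported_on K \<subseteq> module.span fscale ((\<lambda>k k'. if k' = k then 1 else 0) ` K)"
proof
  interpret vector_space fscale by (rule vector_space_fscale)
  fix x :: "'a \<Rightarrow> complex" assume x: "x \<in> supported_on K"
  show "x \<in> span ((\<lambda>k k'. if k' = k then 1 else 0) ` K)"
    by (subst supported_on_expand[OF assms x]) (intro span_sum span_scale span_base imageI)
qed

lemma l1_norm_nonneg: "0 \<le> l1_norm K x"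
  by (simp add: l1_norm_def sum_nonneg)

lemma l1_norm_eq_0: "finite K \<Longrightarrow> x \<in> supported_on K \<Longrightarrow> l1_norm K x \<le> 0 \<Longrightarrow> x = 0"
  using l1_norm_nonneg[of K x]
  by (auto simp: l1_norm_def supported_on_def fun_eq_iff sum_nonneg_eq_0_iff)

text \<open>A linear map is bounded on a finite-dimensional coordinate space by its values on the
  unit vectors. The summand \<open>1\<close> in the constant only makes it positive.\<close>

lemma l1_norm_linear_bound:
  assumes J: "finite J" and lin: "Vector_Spaces.linear fscale fscale g"
  obtains C where "C > 0" "\<And>y. y \<in> supported_on J \<Longrightarrow> l1_norm K (g y) \<le> C * l1_norm J y"
proof
  interpret g: Vector_Spaces.linear fscale fscale g by (rule lin)
  let ?d = "\<lambda>l l'. if l' = l then 1 else 0 :: complex"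
  let ?C = "1 + (\<Sum>l\<in>J. l1_norm K (g (?d l)))"
  show "?C > 0" by (simp add: add_pos_nonneg sum_nonneg l1_norm_nonneg)
  fix y :: "'a \<Rightarrow> complex" assume y: "y \<in> supported_on J"
  have "g y = (\<Sum>l\<in>J. fscale (y l) (g (?d l)))"
    by (subst supported_on_expand[OF J y]) (simp add: g.sum g.scale)
  hence "l1_norm K (g y) = (\<Sum>k\<in>K. cmod (\<Sum>l\<in>J. y l * g (?d l) k))"
    by (simp add: l1_norm_def sum_fun_apply fscale_def)
  also have "\<dots> \<le> (\<Sum>k\<in>K. \<Sum>l\<in>J. cmod (y l) * cmod (g (?d l) k))"
    by (intro sum_mono order.trans[OF norm_sum]) (simp add: norm_mult)
  also have "\<dots> = (\<Sum>l\<in>J. cmod (y l) * l1_norm K (g (?d l)))"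
    by (subst sum.swap) (simp add: l1_norm_def sum_distrib_left)
  also have "\<dots> \<le> (\<Sum>l\<in>J. cmod (y l) * ?C)"
  proof (intro sum_mono mult_left_mono)
    fix l assume "l \<in> J"
    hence "l1_norm K (g (?d l)) \<le> (\<Sum>l\<in>J. l1_norm K (g (?d l)))"
      by (intro member_le_sum J l1_norm_nonneg)
    thus "l1_norm K (g (?d l)) \<le> ?C" by simp
  qed simp
  also have "\<dots> = ?C * l1_norm J y" by (simp only: l1_norm_def sum_distrib_right mult.commute)
  finally show "l1_norm K (g y) \<le> ?C * l1_norm J y" .
qed

text \<open>Kernels of constant dimension vary in a Lipschitz way. Let \<open>g\<close> be a generalized inverse of
  \<open>L0\<close>, so that \<open>L0 g L0 = L0\<close>, and let \<open>Z = 1 + g (L - L0)\<close>, which is close to the identity. On the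
  kernel of \<open>L\<close> it is \<open>1 - g L0\<close>, and \<open>L0 (1 - g L0) = 0\<close>, so \<open>Z\<close> maps the kernel of \<open>L\<close> injectively
  into that of \<open>L0\<close>. The map \<open>T\<close> expresses that the kernel of \<open>L\<close> is at least as large
  as that of \<open>L0\<close>; so \<open>Z \<circ> T\<close> is an injective endomorphism of the kernel of \<open>L0\<close>, hence onto, and every
  \<open>v\<close> in that kernel is \<open>Z w\<close> for some \<open>w\<close> in the kernel of \<open>L\<close>. Finally
  \<open>v - w = g (L - L0) w\<close> is small.\<close>

lemma kernel_perturbation:
  fixes L0 :: "('k \<Rightarrow> complex) \<Rightarrow> ('l \<Rightarrow> complex)"
  assumes K: "finite K" and J: "finite J"
    and L0: "Vector_Spaces.linear fscale fscale L0" "range L0 \<subseteq> supported_on J"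
  obtains C where "C > 0"
    "\<And>L T \<delta> v. \<lbrakk>Vector_Spaces.linear fscale fscale L; range L \<subseteq> supported_on J;
        Vector_Spaces.linear fscale fscale T;
        \<And>x. x \<in> supported_on K \<Longrightarrow> L0 x = 0 \<Longrightarrow> T x \<in> supported_on K \<and> L (T x) = 0;
        \<And>x. x \<in> supported_on K \<Longrightarrow> L0 x = 0 \<Longrightarrow> T x = 0 \<Longrightarrow> x = 0;
        \<And>x. x \<in> supported_on K \<Longrightarrow> l1_norm J (L x - L0 x) \<le> \<delta> * l1_norm K x;
        C * \<delta> \<le> 1 / 2; v \<in> supported_on K; L0 v = 0\<rbrakk>
      \<Longrightarrow> \<exists>w\<in>supported_on K. L w = 0 \<and> l1_norm K (w - v) \<le> 2 * C * \<delta> * l1_norm K v"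
proof -
  interpret L0: Vector_Spaces.linear fscale fscale L0 by (rule L0(1))
  interpret p: vector_space_pair "fscale :: _ \<Rightarrow> ('k \<Rightarrow> complex) \<Rightarrow> _" "fscale :: _ \<Rightarrow> ('l \<Rightarrow> complex) \<Rightarrow> _" ..
  interpret p': vector_space_pair "fscale :: _ \<Rightarrow> ('l \<Rightarrow> complex) \<Rightarrow> _" "fscale :: _ \<Rightarrow> ('k \<Rightarrow> complex) \<Rightarrow> _" ..
  interpret q: vector_space_pair "fscale :: _ \<Rightarrow> ('k \<Rightarrow> complex) \<Rightarrow> _" "fscale :: _ \<Rightarrow> ('k \<Rightarrow> complex) \<Rightarrow> _" ..
  obtain g where g: "range g \<subseteq> supported_on K" "Vector_Spaces.linear fscale fscale g"
      "\<And>x. x \<in> supported_on K \<Longrightarrow> L0 (g (L0 x)) = L0 x"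
    using p.linear_exists_right_inverse_on[OF L0(1) subspace_supported_on[of K]] by blast
  interpret g: Vector_Spaces.linear fscale fscale g by (rule g(2))
  obtain C where C: "C > 0" "\<And>y. y \<in> supported_on J \<Longrightarrow> l1_norm K (g y) \<le> C * l1_norm J y"
    using l1_norm_linear_bound[OF J g(2)] by blast
  show ?thesis
  proof (rule that[OF C(1)])
    fix L T \<delta> v
    assume L: "Vector_Spaces.linear fscale fscale L" "range L \<subseteq> supported_on J"
      and T: "Vector_Spaces.linear fscale fscale T"
        "\<And>x. x \<in> supported_on K \<Longrightarrow> L0 x = 0 \<Longrightarrow> T x \<in> supported_on K \<and> L (T x) = 0"
        "\<And>x. x \<in> supported_on K \<Longrightarrow> L0 x = 0 \<Longrightarrow> T x = 0 \<Longrightarrow> x = 0"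
      and close: "\<And>x. x \<in> supported_on K \<Longrightarrow> l1_norm J (L x - L0 x) \<le> \<delta> * l1_norm K x"
      and small: "C * \<delta> \<le> 1 / 2" and v: "v \<in> supported_on K" "L0 v = 0"
    define Z where "Z x = x + g (L x - L0 x)" for x
    define W where "W = {x \<in> supported_on K. L0 x = 0}"
    interpret L: Vector_Spaces.linear fscale fscale L by (rule L(1))
    have linZ: "Vector_Spaces.linear fscale fscale Z"
      unfolding Z_def
      by (intro q.linear_compose_add L0.vs1.linear_ident
          Vector_Spaces.linear_compose[of fscale fscale "\<lambda>x. L x - L0 x" fscale g, unfolded o_def]
          p.linear_compose_sub L(1) L0(1) g(2))
    have bound: "l1_norm K (g (L x - L0 x)) \<le> C * \<delta> * l1_norm K x" if x: "x \<in> supported_on K" for x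
    proof -
      have "L x - L0 x \<in> supported_on J"
        using L(2) L0(2) by (intro L0.vs2.subspace_diff subspace_supported_on) auto
      hence "l1_norm K (g (L x - L0 x)) \<le> C * l1_norm J (L x - L0 x)" by (rule C(2))
      also have "\<dots> \<le> C * (\<delta> * l1_norm K x)"
        using C(1) close[OF x] by (intro mult_left_mono) auto
      finally show ?thesis by simp
    qed
    \<comment> \<open>So \<open>Z\<close> moves a vector by at most half of its norm, and is injective.\<close>
    have half: "C * \<delta> * l1_norm K x \<le> l1_norm K x / 2" for x
      using mult_right_mono[OF small l1_norm_nonneg[of K x]] by simp
    have triangle: "l1_norm K x \<le> l1_norm K (x + y) + l1_norm K y" for x y
      unfolding l1_norm_def sum.distrib[symmetric]
    proof (rule sum_mono)
      fix k
      show "cmod (x k) \<le> cmod ((x + y) k) + cmod (y k)"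
        using norm_triangle_ineq4[of "x k + y k" "y k"] by simp
    qed
    have le2: "l1_norm K x \<le> 2 * l1_norm K (Z x)" if x: "x \<in> supported_on K" for x
      using triangle[of x "g (L x - L0 x)"] bound[OF x] half[of x] by (simp add: Z_def)
    \<comment> \<open>On the kernel of \<open>L\<close> the map \<open>Z\<close> is \<open>1 - g L0\<close>, which \<open>L0\<close> annihilates.\<close>
    have Z_ker: "Z x \<in> W" if x: "x \<in> supported_on K" "L x = 0" for x
    proof -
      have "g (L x - L0 x) \<in> supported_on K" using g(1) by blast
      hence "Z x \<in> supported_on K"
        unfolding Z_def using x(1) by (intro L0.vs1.subspace_add subspace_supported_on)
      moreover have "L0 (Z x) = 0"
        using g(3)[OF x(1)] by (simp add: Z_def x(2) L0.add L0.diff g.neg L0.neg)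
      ultimately show ?thesis by (simp add: W_def)
    qed
    have subW: "L0.vs1.subspace W"
    proof -
      have "W = supported_on K \<inter> {x. L0 x = 0}" by (auto simp: W_def)
      thus ?thesis
        using L0.vs1.subspace_inter[OF subspace_supported_on L0.subspace_kernel] by simp
    qed
    have linZT: "Vector_Spaces.linear fscale fscale (Z \<circ> T)"
      by (rule Vector_Spaces.linear_compose[OF T(1) linZ])
    have "(Z \<circ> T) ` W = W"
    proof (rule injective_endomorphism_surj_on_finite_dim[OF linZT subW])
      show "finite ((\<lambda>k k'. if k' = k then 1 else 0 :: complex) ` K)" using K by simp
      show "W \<subseteq> L0.vs1.span ((\<lambda>k k'. if k' = k then 1 else 0) ` K)"
        using supported_on_le_span[OF K] by (auto simp: W_def)
      show "(Z \<circ> T) ` W \<subseteq> W" using T(2) Z_ker by (auto simp: W_def)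
      interpret ZT: Vector_Spaces.linear fscale fscale "Z \<circ> T" by (rule linZT)
      show "inj_on (Z \<circ> T) W"
        unfolding ZT.inj_on_iff_eq_0[OF subW]
      proof (intro ballI impI)
        fix x assume x: "x \<in> W" and "(Z \<circ> T) x = 0"
        hence "l1_norm K (T x) \<le> 2 * l1_norm K (0 :: 'k \<Rightarrow> complex)"
          using le2[of "T x"] T(2)[of x] by (simp add: W_def)
        hence "T x = 0"
          using T(2)[of x] x by (intro l1_norm_eq_0[OF K]) (auto simp: W_def l1_norm_def)
        thus "x = 0" using T(3)[of x] x by (simp add: W_def)
      qed
    qed
    moreover have "v \<in> W" using v by (simp add: W_def)
    ultimately obtain c where c: "c \<in> W" "v = Z (T c)" by auto
    define w where "w = T c"
    have w: "w \<in> supported_on K" "L w = 0" "v = Z w"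
      using T(2)[of c] c by (auto simp: W_def w_def)
    have "l1_norm K (w - v) = l1_norm K (g (L w - L0 w))"
      unfolding w(3) Z_def by (simp add: l1_norm_def norm_minus_commute)
    also have "\<dots> \<le> C * \<delta> * l1_norm K w" by (rule bound[OF w(1)])
    also have "\<dots> \<le> C * \<delta> * (2 * l1_norm K v)"
    proof (cases "\<delta> \<ge> 0")
      case True
      thus ?thesis using le2[OF w(1)] C(1) w(3) by (intro mult_left_mono) auto
    next
      case False
      have "0 \<le> C * \<delta> * l1_norm K w"
        using bound[OF w(1)] l1_norm_nonneg[of K] order.trans by blast
      hence "l1_norm K w \<le> 0"
        using False C(1) by (simp add: zero_le_mult_iff mult_less_0_iff not_le)
      hence "w = 0" by (rule l1_norm_eq_0[OF K w(1)])
      hence "v = 0" using w(3) Z_def L.zero L0.zero g.zero by simp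
      thus ?thesis using \<open>w = 0\<close> by (simp add: l1_norm_def)
    qed
    finally show "\<exists>w\<in>supported_on K. L w = 0 \<and> l1_norm K (w - v) \<le> 2 * C * \<delta> * l1_norm K v"
      using w by (intro bexI[of _ w]) auto
  qed
qed

section \<open>Morphisms of doubled representations\<close>

text \<open>In the doubled representation \<open>X True i\<close> stands for \<open>S i\<close> and \<open>X False i\<close> for the inverse transpose
  of \<open>S i\<close>. The two sides of an edge say which of these acts at its target and at its source: a space of
  linear forms appears as the codomain for an undirected edge, and as the domain for
  a bidirected one.\<close>

fun tgt_side :: "edge_ends \<Rightarrow> bool" where
  "tgt_side (Undirected i j) = False"
| "tgt_side (Directed i j) = True"
| "tgt_side (Bidirected i j) = True"

fun src_side :: "edge_ends \<Rightarrow> bool" where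
  "src_side (Undirected i j) = True"
| "src_side (Directed i j) = True"
| "src_side (Bidirected i j) = False"

text \<open>The second equation is the transpose of the first one with both sides exchanged. It says that the
  dual of the edge matrix is intertwined as well, and it makes the equations invariant under the duality
  that sends \<open>X s i\<close> to the inverse transpose of \<open>X (\<not> s) i\<close>.\<close>

definition doubled_hom :: "'e bidir_graph \<Rightarrow> ('e \<Rightarrow> complex mat) \<Rightarrow> ('e \<Rightarrow> complex mat)
    \<Rightarrow> (bool \<Rightarrow> nat \<Rightarrow> complex mat) \<Rightarrow> bool" where
  "doubled_hom G B A X \<longleftrightarrow> (\<forall>e\<in>edge_set G.
     let j = edge_tgt (ends_of G e); i = edge_src (ends_of G e);
         p = tgt_side (ends_of G e); q = src_side (ends_of G e)
     in X p j * B e = A e * X q i \<and> (X (\<not> p) j)\<^sup>T * A e = B e * (X (\<not> q) i)\<^sup>T)"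

lemma inverse_intertwines:
  fixes A B :: "complex mat"
  assumes A: "A \<in> carrier_mat a b" and B: "B \<in> carrier_mat a b"
    and g: "g \<in> carrier_mat a a" "g' \<in> carrier_mat a a" "g' * g = 1\<^sub>m a"
    and h: "h \<in> carrier_mat b b" "h' \<in> carrier_mat b b" "h * h' = 1\<^sub>m b"
    and eq: "A * h = g * B"
  shows "g' * A = B * h'"
proof -
  have "g' * A = g' * (A * (h * h'))" using A g h by simp
  also have "\<dots> = g' * ((A * h) * h')" using A g h by (simp add: assoc_mult_mat[of A a b h b h' b])
  also have "\<dots> = g' * (g * (B * h'))"
    unfolding eq using B g h by (simp add: assoc_mult_mat[of g a a B b h' b])
  also have "\<dots> = (g' * g) * (B * h')"
    by (rule assoc_mult_mat[symmetric, of _ a a _ a _ b]) (use B g h in auto)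
  also have "\<dots> = B * h'" using B h g by simp
  finally show ?thesis .
qed

text \<open>The columns of \<open>S i\<close> are the images of the unit vectors. Each coordinate of \<open>\<phi> i\<close> is a linear form
  on the space at \<open>i\<close>, hence given by its values on the unit vectors.\<close>

lemma rep_isomorphic_imp_mat_isomorphism:
  assumes G: "bidirected_graph G" and B: "matrix_rep G n B" and iso: "rep_isomorphic G n B A"
  obtains S where "mat_isomorphism G n B A S"
proof -
  obtain \<phi> where \<phi>: "rep_isomorphism G n B A \<phi>" using iso by (auto simp: rep_isomorphic_def)
  define S where "S i = mat (n i) (n i) (\<lambda>(a, b). \<phi> i (unit_vec (n i) b) $ a)" for i
  have S: "S i \<in> carrier_mat (n i) (n i)" for i by (simp add: S_def)
  have eq: "\<phi> i x = S i *\<^sub>v x" if i: "i \<in> {1..vertex_count G}" and x: "x \<in> carrier_vec (n i)" for i x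
  proof -
    have lin: "linear_on_vec (n i) (n i) (\<phi> i)" using \<phi> i by (auto simp: rep_isomorphism_def)
    hence c: "\<phi> i x \<in> carrier_vec (n i)" using x by (auto simp: linear_on_vec_def)
    show ?thesis
    proof (rule eq_vecI)
      fix a assume "a < dim_vec (S i *\<^sub>v x)"
      hence a: "a < n i" using S[of i] by simp
      have d: "(\<lambda>x. \<phi> i x $ a) \<in> dual_vecs (n i)"
      proof -
        have "\<phi> i y \<in> carrier_vec (n i)" if "y \<in> carrier_vec (n i)" for y
          using lin that by (auto simp: linear_on_vec_def)
        thus ?thesis using lin a by (fastforce simp: dual_vecs_def linear_on_vec_def)
      qed
      have "\<phi> i x $ a = dual_coords (n i) (\<lambda>x. \<phi> i x $ a) \<bullet> x"
        by (rule dual_vecs_sum[OF d x])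
      also have "dual_coords (n i) (\<lambda>x. \<phi> i x $ a) = row (S i) a"
        using a by (intro eq_vecI) (auto simp: dual_coords_def S_def)
      finally show "\<phi> i x $ a = (S i *\<^sub>v x) $ a" using a S[of i] by simp
    qed (use c S[of i] in auto)
  qed
  have "rep_isomorphism G n B A (\<lambda>i x. S i *\<^sub>v x)"
    unfolding rep_isomorphism_def
  proof (intro conjI ballI)
    fix i assume i: "i \<in> {1..vertex_count G}"
    show "linear_on_vec (n i) (n i) (\<lambda>x. S i *\<^sub>v x)"
      using S[of i] by (auto simp: linear_on_vec_def mult_add_distrib_mat_vec[of _ _ "n i"] mult_mat_vec[of _ _ "n i"])
    show "bij_betw (\<lambda>x. S i *\<^sub>v x) (carrier_vec (n i)) (carrier_vec (n i))"
      using \<phi> i eq[OF i]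
        bij_betw_cong[of "carrier_vec (n i)" "\<phi> i" "\<lambda>x. S i *\<^sub>v x" "carrier_vec (n i)"]
      unfolding rep_isomorphism_def by blast
  next
    fix e assume e: "e \<in> edge_set G"
    have compat: "edge_compat n \<phi> (ends_of G e) (B e) (A e)"
      using \<phi> e by (auto simp: rep_isomorphism_def)
    have wf: "wf_ends (vertex_count G) (ends_of G e)"
      and cB: "B e \<in> carrier_mat (n (edge_tgt (ends_of G e))) (n (edge_src (ends_of G e)))"
      using G B e by (auto simp: bidirected_graph_def matrix_rep_def)
    show "edge_compat n (\<lambda>i x. S i *\<^sub>v x) (ends_of G e) (B e) (A e)"
    proof (cases "ends_of G e")
      case (Undirected i j)
      thus ?thesis using compat wf by (simp add: eq)
    next
      case (Directed i j)
      thus ?thesis using compat wf cB by (simp add: eq)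
    next
      case (Bidirected i j)
      have "dual_coords (n i) (dual_map (\<phi> i) \<xi>) = dual_coords (n i) (dual_map (\<lambda>x. S i *\<^sub>v x) \<xi>)"
        if "i \<in> {1..vertex_count G}" for i \<xi>
        using eq[OF that] by (auto simp: dual_coords_def dual_map_def)
      thus ?thesis using Bidirected compat wf cB by (simp add: mat_dual_form_def)
    qed
  qed
  hence "mat_isomorphism G n B A S" using S by (simp add: mat_isomorphism_def)
  thus ?thesis by (rule that)
qed

lemma invertible_matE:
  assumes "invertible_mat S" "S \<in> carrier_mat m m"
  obtains S' where "S' \<in> carrier_mat m m" "S * S' = 1\<^sub>m m" "S' * S = 1\<^sub>m m"
proof -
  obtain S' where S': "S * S' = 1\<^sub>m m" "S' * S = 1\<^sub>m (dim_row S')"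
    using assms by (auto simp: invertible_mat_def inverts_mat_def)
  have "S' \<in> carrier_mat m m"
    using arg_cong[OF S'(1), of dim_col] arg_cong[OF S'(2), of dim_col] assms(2) by auto
  with S' that show ?thesis by auto
qed

lemma mat_isomorphism_imp_doubled_hom:
  assumes G: "bidirected_graph G" and A: "matrix_rep G n A" and B: "matrix_rep G n B"
    and iso: "mat_isomorphism G n B A S"
    and S': "\<And>i. i \<in> {1..vertex_count G} \<Longrightarrow>
      S' i \<in> carrier_mat (n i) (n i) \<and> S i * S' i = 1\<^sub>m (n i) \<and> S' i * S i = 1\<^sub>m (n i)"
  shows "doubled_hom G B A (\<lambda>s i. if s then S i else (S' i)\<^sup>T)"
  unfolding doubled_hom_def
proof
  fix e assume e: "e \<in> edge_set G"
  let ?X = "\<lambda>s i. if s then S i else (S' i)\<^sup>T"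
  have wf: "wf_ends (vertex_count G) (ends_of G e)"
    and c: "A e \<in> carrier_mat (n (edge_tgt (ends_of G e))) (n (edge_src (ends_of G e)))"
     "B e \<in> carrier_mat (n (edge_tgt (ends_of G e))) (n (edge_src (ends_of G e)))"
    using G A B e by (auto simp: bidirected_graph_def matrix_rep_def)
  have iso': "\<And>i. i \<in> {1..vertex_count G} \<Longrightarrow> S i \<in> carrier_mat (n i) (n i)"
    "case ends_of G e of
        Undirected i j \<Rightarrow> B e = (S j)\<^sup>T * A e * S i
      | Directed i j \<Rightarrow> S j * B e = A e * S i
      | Bidirected i j \<Rightarrow> S j * B e * (S i)\<^sup>T = A e"
    using iso e unfolding mat_isomorphism_iff[OF G B A] by auto
  show "let j = edge_tgt (ends_of G e); i = edge_src (ends_of G e);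
         p = tgt_side (ends_of G e); q = src_side (ends_of G e)
     in ?X p j * B e = A e * ?X q i \<and> (?X (\<not> p) j)\<^sup>T * A e = B e * (?X (\<not> q) i)\<^sup>T"
  proof (cases "ends_of G e")
    case (Undirected i j)
    hence ij: "i \<in> {1..vertex_count G}" "j \<in> {1..vertex_count G}" using wf by auto
    note Sc = iso'(1)[OF ij(1)] iso'(1)[OF ij(2)] and Si = S'[OF ij(1)] S'[OF ij(2)]
    have c': "A e \<in> carrier_mat (n j) (n i)" using c Undirected by simp
    have eq: "B e = (S j)\<^sup>T * A e * S i" using iso'(2) Undirected by simp
    have inv: "(S' j)\<^sup>T * (S j)\<^sup>T = 1\<^sub>m (n j)"
      using transpose_mult[of "S j" "n j" "n j" "S' j" "n j"] Si Sc by simp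
    have "(S' j)\<^sup>T * B e = ((S' j)\<^sup>T * (S j)\<^sup>T) * (A e * S i)"
      unfolding eq using Si Sc c'
      by (simp add: assoc_mult_mat[of _ "n j" "n j" _ "n j" _ "n i"] assoc_mult_mat[of _ "n j" "n j" _ "n i" _ "n i"])
    moreover have "B e * S' i = (S j)\<^sup>T * A e * (S i * S' i)"
      unfolding eq by (rule assoc_mult_mat) (use Si Sc c' in auto)
    ultimately show ?thesis using Undirected inv c' Sc Si by simp
  next
    case (Directed i j)
    hence ij: "i \<in> {1..vertex_count G}" "j \<in> {1..vertex_count G}" using wf by auto
    note Sc = iso'(1)[OF ij(1)] iso'(1)[OF ij(2)] and Si = S'[OF ij(1)] S'[OF ij(2)]
    have c': "A e \<in> carrier_mat (n j) (n i)" "B e \<in> carrier_mat (n j) (n i)" using c Directed by auto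
    have eq: "S j * B e = A e * S i" using iso'(2) Directed by simp
    have "B e * S' i = S' j * A e"
      by (rule inverse_intertwines[OF c' _ _ _ _ _ _ eq[symmetric], symmetric]) (use Sc Si in auto)
    thus ?thesis using Directed eq by simp
  next
    case (Bidirected i j)
    hence ij: "i \<in> {1..vertex_count G}" "j \<in> {1..vertex_count G}" using wf by auto
    note Sc = iso'(1)[OF ij(1)] iso'(1)[OF ij(2)] and Si = S'[OF ij(1)] S'[OF ij(2)]
    have c': "B e \<in> carrier_mat (n j) (n i)" using c Bidirected by simp
    have eq: "A e = S j * B e * (S i)\<^sup>T" using iso'(2) Bidirected by simp
    have inv: "(S i)\<^sup>T * (S' i)\<^sup>T = 1\<^sub>m (n i)"
      using transpose_mult[of "S' i" "n i" "n i" "S i" "n i"] Si Sc by simp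
    have "A e * (S' i)\<^sup>T = S j * B e * ((S i)\<^sup>T * (S' i)\<^sup>T)"
      unfolding eq by (rule assoc_mult_mat) (use Si Sc c' in auto)
    moreover have "S' j * A e = (S' j * S j) * (B e * (S i)\<^sup>T)"
    proof -
      have "S' j * A e = S' j * (S j * (B e * (S i)\<^sup>T))"
        unfolding eq using Sc c' by simp
      also have "\<dots> = (S' j * S j) * (B e * (S i)\<^sup>T)"
        by (rule assoc_mult_mat[symmetric, of _ "n j" "n j" _ "n j" _ "n i"]) (use Si Sc c' in auto)
      finally show ?thesis .
    qed
    ultimately show ?thesis using Bidirected inv c' Sc Si by simp
  qed
qed

section \<open>From morphisms of doubled representations to isomorphisms\<close>

lemma regroup_mult_mat4:
  fixes A :: "complex mat"
  assumes "A \<in> carrier_mat a b" "B \<in> carrier_mat b c" "C \<in> carrier_mat c d" "D \<in> carrier_mat d f"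
  shows "(A * B) * (C * D) = A * ((B * C) * D)"
proof -
  have "(A * B) * (C * D) = A * (B * (C * D))"
    by (rule assoc_mult_mat) (use assms in auto)
  also have "B * (C * D) = (B * C) * D"
    by (rule assoc_mult_mat[symmetric]) (use assms in auto)
  finally show ?thesis .
qed

text \<open>With \<open>N = S R\<^sup>T - 1\<close> small, \<open>h = 1 + sqrt_incr N\<close> is the square root of \<open>S R\<^sup>T\<close>. The identity
  \<open>R\<^sup>T h\<^sup>-\<^sup>1 h\<^sup>-\<^sup>1 S = 1\<close> says that \<open>(h\<^sup>-\<^sup>1 S, h\<^sup>-\<^sup>T R)\<close> is self-dual; it follows from
  \<open>S R\<^sup>T h\<^sup>-\<^sup>2 = 1\<close>, since a right inverse of a square matrix is also a left inverse. The hypothesis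
  \<open>\<eta> \<le> 1 / 12\<close> gives \<open>norm N \<le> \<eta>\<^sup>2 + 2 \<eta> \<le> 3 \<eta> \<le> 1 / 4\<close>, the radius in which the square root exists.\<close>

lemma symmetrize_at_vertex:
  assumes S: "S \<in> carrier_mat m m" and R: "R \<in> carrier_mat m m"
    and near: "entry_norm (S - 1\<^sub>m m) \<le> \<eta>" "entry_norm (R - 1\<^sub>m m) \<le> \<eta>" and \<eta>: "\<eta> \<le> 1 / 12"
  defines "N \<equiv> S * R\<^sup>T - 1\<^sub>m m"
  obtains h' where "h' \<in> carrier_mat m m" "entry_norm N \<le> 1 / 4"
    "(1\<^sub>m m + sqrt_incr N) * (1\<^sub>m m + sqrt_incr N) = S * R\<^sup>T"
    "(1\<^sub>m m + sqrt_incr N) * h' = 1\<^sub>m m" "h' * (1\<^sub>m m + sqrt_incr N) = 1\<^sub>m m"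
    "R\<^sup>T * (h' * (h' * S)) = 1\<^sub>m m" "invertible_mat (h' * S)"
    "entry_norm (h' * S - 1\<^sub>m m) \<le> 8 * \<eta>"
proof -
  define u where "u = sqrt_incr N"
  define h where "h = 1\<^sub>m m + u"
  have \<eta>0: "0 \<le> \<eta>" using near(1) entry_norm_nonneg order.trans by blast
  have N: "N \<in> carrier_mat m m" by (auto simp: N_def)
  have cD: "S - 1\<^sub>m m \<in> carrier_mat m m" "R\<^sup>T - 1\<^sub>m m \<in> carrier_mat m m" using S R by auto
  have "(R - 1\<^sub>m m)\<^sup>T = R\<^sup>T - 1\<^sub>m m" using R by (intro eq_matI) auto
  hence nearT: "entry_norm (R\<^sup>T - 1\<^sub>m m) \<le> \<eta>" using near(2) by (metis entry_norm_transpose)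
  have "S * R\<^sup>T - 1\<^sub>m m = (S - 1\<^sub>m m) * (R\<^sup>T - 1\<^sub>m m) + ((S - 1\<^sub>m m) + (R\<^sup>T - 1\<^sub>m m))"
  proof -
    have "(S - 1\<^sub>m m) * (R\<^sup>T - 1\<^sub>m m) = S * (R\<^sup>T - 1\<^sub>m m) - 1\<^sub>m m * (R\<^sup>T - 1\<^sub>m m)"
      by (rule minus_mult_distrib_mat) (use S cD in auto)
    also have "S * (R\<^sup>T - 1\<^sub>m m) = S * R\<^sup>T - S * 1\<^sub>m m"
      by (rule mult_minus_distrib_mat) (use S R in auto)
    finally have "(S - 1\<^sub>m m) * (R\<^sup>T - 1\<^sub>m m) = (S * R\<^sup>T - S) - (R\<^sup>T - 1\<^sub>m m)"
      using S cD by simp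
    thus ?thesis using S R by (intro eq_matI) (auto simp del: index_mult_mat(1))
  qed
  hence "entry_norm N \<le> entry_norm ((S - 1\<^sub>m m) * (R\<^sup>T - 1\<^sub>m m)) + entry_norm ((S - 1\<^sub>m m) + (R\<^sup>T - 1\<^sub>m m))"
    unfolding N_def using cD by (simp only:) (rule entry_norm_add_le[of _ m m]; auto)
  also have "entry_norm ((S - 1\<^sub>m m) * (R\<^sup>T - 1\<^sub>m m)) \<le> \<eta> * \<eta>"
    using entry_norm_mult_le[OF cD] near(1) nearT \<eta>0
    by (meson entry_norm_nonneg mult_mono order.trans)
  also have "\<eta> * \<eta> \<le> \<eta> * 1" using \<eta> \<eta>0 by (intro mult_left_mono) auto
  also have "entry_norm ((S - 1\<^sub>m m) + (R\<^sup>T - 1\<^sub>m m)) \<le> 2 * \<eta>"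
    using entry_norm_add_le[OF cD] near(1) nearT by linarith
  finally have N3: "entry_norm N \<le> 3 * \<eta>" by simp
  hence N4: "entry_norm N \<le> 1 / 4" using \<eta> by simp
  have u: "u \<in> carrier_mat m m" by (simp add: u_def sqrt_incr_carrier[OF N])
  have u3: "entry_norm u \<le> 3 * \<eta>" using entry_norm_sqrt_incr_le[OF N N4] N3 by (simp add: u_def)
  have h: "h \<in> carrier_mat m m" using u by (simp add: h_def)
  have "1\<^sub>m m + N = S * R\<^sup>T" unfolding N_def using S R by (intro eq_matI) auto
  hence hh: "h * h = S * R\<^sup>T" using sqrt_incr_square[OF N N4] by (simp add: h_def u_def)
  have "h - 1\<^sub>m m = u" using u by (intro eq_matI) (auto simp: h_def)
  hence "entry_norm (h - 1\<^sub>m m) < 1" using u3 \<eta> by simp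
  then obtain h' where h': "h' \<in> carrier_mat m m" "h * h' = 1\<^sub>m m" "h' * h = 1\<^sub>m m"
    by (rule invertible_near_one[OF h])
  have "entry_norm (S - 1\<^sub>m m) < 1" using near(1) \<eta> by simp
  then obtain Si where Si: "Si \<in> carrier_mat m m" "S * Si = 1\<^sub>m m" "Si * S = 1\<^sub>m m"
    by (rule invertible_near_one[OF S])
  have S'c: "h' * S \<in> carrier_mat m m" using h' S by auto
  have "S * (R\<^sup>T * (h' * h')) = (h * h) * (h' * h')"
    unfolding hh by (rule assoc_mult_mat[symmetric, of _ m m _ m _ m]) (use S R h' in auto)
  also have "\<dots> = h * ((h * h') * h')" by (rule regroup_mult_mat4) (use h h'(1) in auto)
  also have "\<dots> = 1\<^sub>m m" using h h' by (simp del: assoc_mult_mat)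
  finally have "(R\<^sup>T * (h' * h')) * S = 1\<^sub>m m"
    using mat_mult_left_right_inverse[OF S, of "R\<^sup>T * (h' * h')"] R h' by auto
  moreover have "(R\<^sup>T * (h' * h')) * S = R\<^sup>T * ((h' * h') * S)"
    by (rule assoc_mult_mat) (use R h' S in auto)
  moreover have "(h' * h') * S = h' * (h' * S)"
    by (rule assoc_mult_mat) (use h' S in auto)
  ultimately have inv: "R\<^sup>T * (h' * (h' * S)) = 1\<^sub>m m" by simp
  have "invertible_mat (h' * S)"
  proof -
    have "(h' * S) * (Si * h) = h' * ((S * Si) * h)"
      by (rule regroup_mult_mat4) (use h h'(1) S Si(1) in auto)
    hence 1: "(h' * S) * (Si * h) = 1\<^sub>m m" using h h' Si(2) by (simp del: assoc_mult_mat)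
    moreover have "Si * h \<in> carrier_mat m m" using Si h by auto
    ultimately have "(Si * h) * (h' * S) = 1\<^sub>m m" using mat_mult_left_right_inverse[OF S'c] by blast
    with 1 show ?thesis
      unfolding invertible_mat_def inverts_mat_def
      by (intro conjI exI[of _ "Si * h"]) (use h h'(1) S Si(1) in auto)
  qed
  moreover have "entry_norm (h' * S - 1\<^sub>m m) \<le> 8 * \<eta>"
  proof -
    define D where "D = h' * S - 1\<^sub>m m"
    have D: "D \<in> carrier_mat m m" unfolding D_def by (rule minus_carrier_mat) simp
    have "h * (h' * S) = (h * h') * S"
      by (rule assoc_mult_mat[symmetric]) (use h h'(1) S in auto)
    hence "h * (h' * S) = S" using S h'(2) by simp
    moreover have "h * (h' * S) = (1\<^sub>m m + D) + u * (1\<^sub>m m + D)"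
    proof -
      have "h' * S = 1\<^sub>m m + D" unfolding D_def using S'c by (intro eq_matI) (auto simp del: index_mult_mat(1))
      thus ?thesis unfolding h_def using u D by (simp add: add_mult_distrib_mat[of _ m m _ _ m])
    qed
    moreover have "u * (1\<^sub>m m + D) = u + u * D" using u D by (simp add: mult_add_distrib_mat[of _ m m _ m])
    \<comment> \<open>The relation \<open>h (1 + D) = S\<close> with \<open>h = 1 + u\<close> is solved for \<open>D = (S - 1) - u - u D\<close>, and the last term is absorbed on the left.\<close>
    ultimately have SD: "S = (1\<^sub>m m + D) + (u + u * D)" by simp
    have "D = ((S - 1\<^sub>m m) - u) - u * D"
      by (subst SD) (use u D in \<open>intro eq_matI; auto simp del: index_mult_mat(1)\<close>)
    hence "entry_norm D = entry_norm (((S - 1\<^sub>m m) - u) - u * D)" by (rule arg_cong)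
    also have "\<dots> \<le> entry_norm ((S - 1\<^sub>m m) - u) + entry_norm (u * D)"
      by (rule entry_norm_diff_le[OF minus_carrier_mat[OF u]]) (use u D in auto)
    also have "entry_norm ((S - 1\<^sub>m m) - u) \<le> \<eta> + 3 * \<eta>"
      using entry_norm_diff_le[OF cD(1) u] near(1) u3 by linarith
    also have "entry_norm (u * D) \<le> entry_norm u * entry_norm D" by (rule entry_norm_mult_le[OF u D])
    also have "\<dots> \<le> 1 / 4 * entry_norm D"
      using u3 \<eta> entry_norm_nonneg by (intro mult_right_mono) auto
    finally have "entry_norm D \<le> 4 * \<eta> + entry_norm D / 4" by simp
    thus ?thesis using \<eta>0 unfolding D_def by linarith
  qed
  ultimately show ?thesis using that[of h'] h' N4 hh inv by (simp add: h_def u_def)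
qed

lemma add_sqrt_incr_intertwines:
  assumes C: "C \<in> carrier_mat a b" and P: "P \<in> carrier_mat b b" and Q: "Q \<in> carrier_mat a a"
    and eq: "C * P = Q * C"
    and small: "entry_norm (P - 1\<^sub>m b) \<le> 1 / 4" "entry_norm (Q - 1\<^sub>m a) \<le> 1 / 4"
  shows "C * (1\<^sub>m b + sqrt_incr (P - 1\<^sub>m b)) = (1\<^sub>m a + sqrt_incr (Q - 1\<^sub>m a)) * C"
proof -
  have c: "P - 1\<^sub>m b \<in> carrier_mat b b" "Q - 1\<^sub>m a \<in> carrier_mat a a" using P Q by auto
  have "C * (P - 1\<^sub>m b) = (Q - 1\<^sub>m a) * C"
    using C P Q eq by (simp add: mult_minus_distrib_mat[of _ a b _ b] minus_mult_distrib_mat[of _ a a])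
  \<comment> \<open>The unit matrices commute with everything, so they can be subtracted before and added after.\<close>
  from sqrt_incr_intertwines[OF C c this small] show ?thesis
    using C sqrt_incr_carrier[OF c(1)] sqrt_incr_carrier[OF c(2)]
    by (simp add: mult_add_distrib_mat[of _ a b _ b] add_mult_distrib_mat[of _ a a])
qed

text \<open>The matrices \<open>g i = S i * (R i)\<^sup>T\<close> and their transposes satisfy the intertwining relation of each edge of
  \<open>A\<close>, by combining the two equations of \<open>doubled_hom\<close> for that edge: it reads \<open>A g\<^sub>i = g\<^sub>j\<^sup>T A\<close> for an undirected,
  \<open>A g\<^sub>i = g\<^sub>j A\<close> for a directed and \<open>A g\<^sub>i\<^sup>T = g\<^sub>j A\<close> for a bidirected edge. The square roots
  satisfy the same relations, and so do their inverses. Together with \<open>doubled_hom\<close> and \<open>R\<^sup>T h\<^sup>-\<^sup>2 S = 1\<close> this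
  gives the equations of an isomorphism for \<open>h\<^sup>-\<^sup>1 S\<close>.\<close>

lemma doubled_hom_imp_near_isomorphism:
  assumes G: "bidirected_graph G" and A: "matrix_rep G n A" and B: "matrix_rep G n B"
    and X: "\<And>s i. i \<in> {1..vertex_count G} \<Longrightarrow> X s i \<in> carrier_mat (n i) (n i)"
    and hom: "doubled_hom G B A X"
    and near: "\<And>s i. i \<in> {1..vertex_count G} \<Longrightarrow> entry_norm (X s i - 1\<^sub>m (n i)) \<le> \<eta>" and \<eta>: "\<eta> \<le> 1 / 12"
  obtains S where "mat_isomorphism G n B A S"
    "\<And>i. i \<in> {1..vertex_count G} \<Longrightarrow> entry_norm (S i - 1\<^sub>m (n i)) \<le> 8 * \<eta>"
proof -
  define g where "g i = X True i * (X False i)\<^sup>T" for i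
  define h where "h i = 1\<^sub>m (n i) + sqrt_incr (g i - 1\<^sub>m (n i))" for i
  let ?V = "{1..vertex_count G}"
  define good where "good i h' \<longleftrightarrow> h' \<in> carrier_mat (n i) (n i) \<and> entry_norm (g i - 1\<^sub>m (n i)) \<le> 1 / 4 \<and>
      h i * h i = g i \<and> h i * h' = 1\<^sub>m (n i) \<and> h' * h i = 1\<^sub>m (n i) \<and>
      (X False i)\<^sup>T * (h' * (h' * X True i)) = 1\<^sub>m (n i) \<and> invertible_mat (h' * X True i) \<and>
      entry_norm (h' * X True i - 1\<^sub>m (n i)) \<le> 8 * \<eta>" for i h'
  have "\<exists>h'. good i h'" if i: "i \<in> ?V" for i
    unfolding good_def g_def h_def
    by (rule symmetrize_at_vertex[OF X[OF i] X[OF i] near[OF i] near[OF i] \<eta>, of True False]) blast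
  then obtain h' where good: "\<And>i. i \<in> ?V \<Longrightarrow> good i (h' i)" by metis
  have h': "h' i \<in> carrier_mat (n i) (n i)" "entry_norm (g i - 1\<^sub>m (n i)) \<le> 1 / 4"
      "h i * h i = g i" "h i * h' i = 1\<^sub>m (n i)" "h' i * h i = 1\<^sub>m (n i)"
      "(X False i)\<^sup>T * (h' i * (h' i * X True i)) = 1\<^sub>m (n i)"
      "invertible_mat (h' i * X True i)"
      "entry_norm (h' i * X True i - 1\<^sub>m (n i)) \<le> 8 * \<eta>" if "i \<in> ?V" for i
    using good[OF that] unfolding good_def by blast+
  have gc: "g i \<in> carrier_mat (n i) (n i)" if "i \<in> ?V" for i
    using X[OF that, of True] X[OF that, of False] by (auto simp: g_def)
  have hc: "h i \<in> carrier_mat (n i) (n i)" if "i \<in> ?V" for i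
    unfolding h_def by (intro add_carrier_mat sqrt_incr_carrier minus_carrier_mat one_carrier_mat)
  have gT: "entry_norm ((g i)\<^sup>T - 1\<^sub>m (n i)) \<le> 1 / 4"
      "1\<^sub>m (n i) + sqrt_incr ((g i)\<^sup>T - 1\<^sub>m (n i)) = (h i)\<^sup>T" if i: "i \<in> ?V" for i
  proof -
    have c: "g i - 1\<^sub>m (n i) \<in> carrier_mat (n i) (n i)" using gc[OF i] by auto
    have e: "(g i)\<^sup>T - 1\<^sub>m (n i) = (g i - 1\<^sub>m (n i))\<^sup>T" using gc[OF i] by (intro eq_matI) auto
    show "entry_norm ((g i)\<^sup>T - 1\<^sub>m (n i)) \<le> 1 / 4"
      using h'(2)[OF i] by (simp add: e entry_norm_transpose)
    show "1\<^sub>m (n i) + sqrt_incr ((g i)\<^sup>T - 1\<^sub>m (n i)) = (h i)\<^sup>T"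
      unfolding e sqrt_incr_transpose[OF c] h_def
      using sqrt_incr_carrier[OF c] by (intro eq_matI) auto
  qed
  have gTe: "(g i)\<^sup>T = X False i * (X True i)\<^sup>T" if i: "i \<in> ?V" for i
    unfolding g_def using transpose_mult[of "X True i" "n i" "n i" "(X False i)\<^sup>T" "n i"] X[OF i] by simp
  have h'T: "(h i)\<^sup>T * (h' i)\<^sup>T = 1\<^sub>m (n i)" "(h' i)\<^sup>T * (h i)\<^sup>T = 1\<^sub>m (n i)" if i: "i \<in> ?V" for i
    by (simp_all only: transpose_mult[OF h'(1)[OF i] hc[OF i], symmetric]
        transpose_mult[OF hc[OF i] h'(1)[OF i], symmetric] h'(4,5)[OF i] transpose_one)
  define S where "S i = h' i * X True i" for i
  have Sc: "S i \<in> carrier_mat (n i) (n i)" if "i \<in> ?V" for i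
    using h'(1)[OF that] X[OF that] by (auto simp: S_def)
  have "mat_isomorphism G n B A S"
    unfolding mat_isomorphism_iff[OF G B A]
  proof (intro conjI ballI)
    fix i assume "i \<in> ?V"
    thus "S i \<in> carrier_mat (n i) (n i)" "invertible_mat (S i)" using Sc h'(7) by (auto simp: S_def)
  next
    fix e assume e: "e \<in> edge_set G"
    have wf: "wf_ends (vertex_count G) (ends_of G e)"
      and c: "A e \<in> carrier_mat (n (edge_tgt (ends_of G e))) (n (edge_src (ends_of G e)))"
       "B e \<in> carrier_mat (n (edge_tgt (ends_of G e))) (n (edge_src (ends_of G e)))"
      using G A B e by (auto simp: bidirected_graph_def matrix_rep_def)
    note hom_e = hom[unfolded doubled_hom_def, rule_format, OF e, unfolded Let_def]
    show "case ends_of G e of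
        Undirected i j \<Rightarrow> B e = (S j)\<^sup>T * A e * S i
      | Directed i j \<Rightarrow> S j * B e = A e * S i
      | Bidirected i j \<Rightarrow> S j * B e * (S i)\<^sup>T = A e"
    proof (cases "ends_of G e")
      case (Undirected i j)
      hence i: "i \<in> ?V" and j: "j \<in> ?V" using wf by auto
      have Ae: "A e \<in> carrier_mat (n j) (n i)" and Be: "B e \<in> carrier_mat (n j) (n i)" using c Undirected by auto
      have 1: "X False j * B e = A e * X True i" and 2: "(X True j)\<^sup>T * A e = B e * (X False i)\<^sup>T"
        using hom_e Undirected by auto
      note XX = X[OF i, of True] X[OF i, of False] X[OF j, of True] X[OF j, of False]
        and hh = hc[OF i] hc[OF j] h'(1)[OF i] h'(1)[OF j]
      have "A e * g i = (A e * X True i) * (X False i)\<^sup>T" unfolding g_def by (rule assoc_mult_mat[symmetric]) (use XX Ae in auto)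
      also have "\<dots> = X False j * (B e * (X False i)\<^sup>T)" unfolding 1[symmetric] by (rule assoc_mult_mat) (use XX Be in auto)
      also have "\<dots> = (g j)\<^sup>T * A e" unfolding 2[symmetric] gTe[OF j] by (rule assoc_mult_mat[symmetric]) (use XX Ae in auto)
      finally have "A e * g i = (g j)\<^sup>T * A e" .
      hence "A e * h i = (h j)\<^sup>T * A e"
        using add_sqrt_incr_intertwines[OF Ae gc[OF i] _ _ h'(2)[OF i] gT(1)[OF j]] gc[OF j] gT(2)[OF j]
        by (simp add: h_def)
      hence comm: "(h' j)\<^sup>T * A e = A e * h' i"
        by (intro inverse_intertwines[OF Ae Ae _ _ _ _ _ _ \<open>A e * h i = (h j)\<^sup>T * A e\<close>])
          (use hh h'T(2)[OF j] h'(4)[OF i] in auto)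
      have "(S j)\<^sup>T = (X True j)\<^sup>T * (h' j)\<^sup>T" unfolding S_def by (rule transpose_mult) (use XX hh in auto)
      hence "(S j)\<^sup>T * A e = (X True j)\<^sup>T * ((h' j)\<^sup>T * A e)"
        by (simp only:) (rule assoc_mult_mat, use XX hh Ae in auto)
      also have "\<dots> = ((X True j)\<^sup>T * A e) * h' i"
        unfolding comm by (rule assoc_mult_mat[symmetric]) (use XX hh Ae in auto)
      also have "\<dots> = B e * ((X False i)\<^sup>T * h' i)"
        unfolding 2 by (rule assoc_mult_mat) (use XX hh Be in auto)
      finally have "(S j)\<^sup>T * A e * S i = B e * ((X False i)\<^sup>T * h' i) * S i" by simp
      also have "\<dots> = B e * ((X False i)\<^sup>T * h' i * S i)"
        by (rule assoc_mult_mat) (use XX hh Be Sc[OF i] in auto)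
      also have "(X False i)\<^sup>T * h' i * S i = (X False i)\<^sup>T * (h' i * S i)"
        by (rule assoc_mult_mat) (use XX hh Sc[OF i] in auto)
      also have "B e * ((X False i)\<^sup>T * (h' i * S i)) = B e"
        using h'(6)[OF i] Be by (simp add: S_def)
      finally show ?thesis using Undirected by simp
    next
      case (Directed i j)
      hence i: "i \<in> ?V" and j: "j \<in> ?V" using wf by auto
      have Ae: "A e \<in> carrier_mat (n j) (n i)" and Be: "B e \<in> carrier_mat (n j) (n i)" using c Directed by auto
      have 1: "X True j * B e = A e * X True i" and 2: "(X False j)\<^sup>T * A e = B e * (X False i)\<^sup>T"
        using hom_e Directed by auto
      note XX = X[OF i, of True] X[OF i, of False] X[OF j, of True] X[OF j, of False]
        and hh = hc[OF i] hc[OF j] h'(1)[OF i] h'(1)[OF j]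
      have "A e * g i = (A e * X True i) * (X False i)\<^sup>T" unfolding g_def by (rule assoc_mult_mat[symmetric]) (use XX Ae in auto)
      also have "\<dots> = X True j * (B e * (X False i)\<^sup>T)" unfolding 1[symmetric] by (rule assoc_mult_mat) (use XX Be in auto)
      also have "\<dots> = g j * A e" unfolding 2[symmetric] g_def by (rule assoc_mult_mat[symmetric]) (use XX Ae in auto)
      finally have "A e * g i = g j * A e" .
      hence *: "A e * h i = h j * A e"
        using add_sqrt_incr_intertwines[OF Ae gc[OF i] gc[OF j] _ h'(2)[OF i] h'(2)[OF j]]
        by (simp add: h_def)
      have comm: "h' j * A e = A e * h' i"
        by (rule inverse_intertwines[OF Ae Ae _ _ _ _ _ _ *]) (use hh h'(5)[OF j] h'(4)[OF i] in auto)
      have "S j * B e = h' j * (A e * X True i)" unfolding 1[symmetric] S_def by (rule assoc_mult_mat) (use XX hh Be in auto)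
      also have "\<dots> = (h' j * A e) * X True i" by (rule assoc_mult_mat[symmetric]) (use XX hh Ae in auto)
      also have "\<dots> = A e * S i" unfolding comm S_def by (rule assoc_mult_mat) (use XX hh Ae in auto)
      finally show ?thesis using Directed by simp
    next
      case (Bidirected i j)
      hence i: "i \<in> ?V" and j: "j \<in> ?V" using wf by auto
      have Ae: "A e \<in> carrier_mat (n j) (n i)" and Be: "B e \<in> carrier_mat (n j) (n i)" using c Bidirected by auto
      have 1: "X True j * B e = A e * X False i" and 2: "(X False j)\<^sup>T * A e = B e * (X True i)\<^sup>T"
        using hom_e Bidirected by auto
      note XX = X[OF i, of True] X[OF i, of False] X[OF j, of True] X[OF j, of False]
        and hh = hc[OF i] hc[OF j] h'(1)[OF i] h'(1)[OF j]
      have "A e * (g i)\<^sup>T = (A e * X False i) * (X True i)\<^sup>T" unfolding gTe[OF i] by (rule assoc_mult_mat[symmetric]) (use XX Ae in auto)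
      also have "\<dots> = X True j * (B e * (X True i)\<^sup>T)" unfolding 1[symmetric] by (rule assoc_mult_mat) (use XX Be in auto)
      also have "\<dots> = g j * A e" unfolding 2[symmetric] g_def by (rule assoc_mult_mat[symmetric]) (use XX Ae in auto)
      finally have "A e * (g i)\<^sup>T = g j * A e" .
      hence *: "A e * (h i)\<^sup>T = h j * A e"
        using add_sqrt_incr_intertwines[OF Ae _ gc[OF j] _ gT(1)[OF i] h'(2)[OF j]] gc[OF i] gT(2)[OF i]
        by (simp add: h_def)
      have comm: "h' j * A e = A e * (h' i)\<^sup>T"
        by (rule inverse_intertwines[OF Ae Ae _ _ _ _ _ _ *]) (use hh h'(5)[OF j] h'T(1)[OF i] in auto)
      have hTT: "(h i)\<^sup>T * (h i)\<^sup>T = (g i)\<^sup>T"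
        using transpose_mult[OF hh(1) hh(1)] h'(3)[OF i] by simp
      have "(S i)\<^sup>T = (X True i)\<^sup>T * (h' i)\<^sup>T" unfolding S_def by (rule transpose_mult) (use XX hh in auto)
      hence "B e * (S i)\<^sup>T = (B e * (X True i)\<^sup>T) * (h' i)\<^sup>T"
        by (simp only:) (rule assoc_mult_mat[symmetric], use XX hh Be in auto)
      moreover have "X True j * ((B e * (X True i)\<^sup>T) * (h' i)\<^sup>T)
          = (X True j * (B e * (X True i)\<^sup>T)) * (h' i)\<^sup>T"
        by (rule assoc_mult_mat[symmetric]) (use XX hh Be in auto)
      moreover have "X True j * (B e * (X True i)\<^sup>T) = A e * (g i)\<^sup>T"
      proof -
        have "X True j * (B e * (X True i)\<^sup>T) = (X True j * B e) * (X True i)\<^sup>T"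
          by (rule assoc_mult_mat[symmetric]) (use XX Be in auto)
        also have "\<dots> = A e * (g i)\<^sup>T"
          unfolding 1 gTe[OF i] by (rule assoc_mult_mat) (use XX Ae in auto)
        finally show ?thesis .
      qed
      moreover have "A e * (g i)\<^sup>T = (A e * (h i)\<^sup>T) * (h i)\<^sup>T"
        unfolding hTT[symmetric] by (rule assoc_mult_mat[symmetric]) (use hh Ae in auto)
      moreover have "(A e * (h i)\<^sup>T) * (h i)\<^sup>T * (h' i)\<^sup>T = (A e * (h i)\<^sup>T) * ((h i)\<^sup>T * (h' i)\<^sup>T)"
        by (rule assoc_mult_mat) (use hh Ae in auto)
      ultimately have "X True j * (B e * (S i)\<^sup>T) = h j * A e"
        using h'T(1)[OF i] hh Ae * by simp
      hence "h' j * (X True j * (B e * (S i)\<^sup>T)) = h' j * (h j * A e)" by simp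
      also have "\<dots> = (h' j * h j) * A e"
        by (rule assoc_mult_mat[symmetric]) (use hh Ae in auto)
      also have "\<dots> = A e" using h'(5)[OF j] Ae by simp
      finally have "h' j * (X True j * (B e * (S i)\<^sup>T)) = A e" .
      moreover have "h' j * (X True j * (B e * (S i)\<^sup>T)) = S j * (B e * (S i)\<^sup>T)"
        unfolding S_def by (rule assoc_mult_mat[symmetric]) (use XX hh Be in auto)
      moreover have "S j * (B e * (S i)\<^sup>T) = S j * B e * (S i)\<^sup>T"
        by (rule assoc_mult_mat[symmetric]) (use Sc[OF i] Sc[OF j] Be in auto)
      ultimately have "S j * B e * (S i)\<^sup>T = A e" by simp
      thus ?thesis using Bidirected by simp
    qed
  qed
  thus ?thesis using that h'(8) by (auto simp: S_def)
qed

section \<open>The linear system of the doubled morphisms\<close>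

text \<open>A family \<open>X\<close> of square matrices, one for each side and each vertex, is encoded as one function on the set of
  all its entries (side, vertex, row, column), to which the perturbation of kernels applies.\<close>

definition coord_set :: "nat \<Rightarrow> (nat \<Rightarrow> nat) \<Rightarrow> (bool \<times> nat \<times> nat \<times> nat) set" where
  "coord_set t n = UNIV \<times> (SIGMA i:{1..t}. {..<n i} \<times> {..<n i})"

definition block :: "(nat \<Rightarrow> nat) \<Rightarrow> (bool \<times> nat \<times> nat \<times> nat \<Rightarrow> complex) \<Rightarrow> bool \<Rightarrow> nat \<Rightarrow> complex mat" where
  "block n x s i = mat (n i) (n i) (\<lambda>(a, b). x (s, i, a, b))"

definition unblock :: "nat \<Rightarrow> (nat \<Rightarrow> nat) \<Rightarrow> (bool \<Rightarrow> nat \<Rightarrow> complex mat)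
    \<Rightarrow> bool \<times> nat \<times> nat \<times> nat \<Rightarrow> complex" where
  "unblock t n X = (\<lambda>(s, i, a, b). if (s, i, a, b) \<in> coord_set t n then X s i $$ (a, b) else 0)"

lemma finite_coord_set: "finite (coord_set t n)"
  by (auto simp: coord_set_def intro!: finite_cartesian_product finite_SigmaI)

lemma block_carrier: "block n x s i \<in> carrier_mat (n i) (n i)"
  by (simp add: block_def)

lemma unblock_supported: "unblock t n X \<in> supported_on (coord_set t n)"
  by (auto simp: unblock_def supported_on_def)

lemma block_unblock:
  "i \<in> {1..t} \<Longrightarrow> X s i \<in> carrier_mat (n i) (n i) \<Longrightarrow> block n (unblock t n X) s i = X s i"
  by (auto simp: block_def unblock_def coord_set_def)

lemma block_add: "block n (x + y) s i = block n x s i + block n y s i"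
  by (intro eq_matI) (auto simp: block_def)

lemma block_diff: "block n (x - y) s i = block n x s i - block n y s i"
  by (intro eq_matI) (auto simp: block_def)

lemma block_fscale: "block n (fscale c x) s i = c \<cdot>\<^sub>m block n x s i"
  by (intro eq_matI) (auto simp: block_def fscale_def)

lemma l1_norm_coord_set:
  "l1_norm (coord_set t n) x = (\<Sum>s\<in>UNIV. \<Sum>i=1..t. entry_norm (block n x s i))"
proof -
  have "entry_norm (block n x s i) = (\<Sum>p\<in>{..<n i} \<times> {..<n i}. cmod (x (s, i, p)))" for s i
    unfolding entry_norm_carrier[OF block_carrier] sum.cartesian_product
    by (rule sum.cong) (auto simp: block_def)
  hence "(\<Sum>s\<in>UNIV. \<Sum>i=1..t. entry_norm (block n x s i))
      = (\<Sum>s\<in>UNIV. \<Sum>i=1..t. \<Sum>p\<in>{..<n i} \<times> {..<n i}. cmod (x (s, i, p)))"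
    by simp
  also have "\<dots> = (\<Sum>s\<in>UNIV. \<Sum>q\<in>(SIGMA i:{1..t}. {..<n i} \<times> {..<n i}). cmod (x (s, q)))"
    by (intro sum.cong refl) (simp add: sum.Sigma)
  also have "\<dots> = l1_norm (coord_set t n) x"
    by (simp add: l1_norm_def coord_set_def sum.cartesian_product)
  finally show ?thesis by simp
qed

lemma entry_norm_block_le:
  assumes "i \<in> {1..t}"
  shows "entry_norm (block n x s i) \<le> l1_norm (coord_set t n) x"
proof -
  have "entry_norm (block n x s i) \<le> (\<Sum>i=1..t. entry_norm (block n x s i))"
    by (rule member_le_sum) (use assms entry_norm_nonneg in auto)
  also have "\<dots> \<le> l1_norm (coord_set t n) x"
    unfolding l1_norm_coord_set
    by (rule member_le_sum[of s UNIV "\<lambda>s. \<Sum>i=1..t. entry_norm (block n x s i)"])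
      (auto intro!: sum_nonneg entry_norm_nonneg)
  finally show ?thesis .
qed

lemma edge_matrix_carrier:
  assumes "matrix_rep G n B" "e \<in> edge_set G"
  shows "B e \<in> carrier_mat (n (edge_tgt (ends_of G e))) (n (edge_src (ends_of G e)))"
  using assms by (simp add: matrix_rep_def)

lemma edge_ends_in:
  assumes "bidirected_graph G" "e \<in> edge_set G"
  shows "edge_tgt (ends_of G e) \<in> {1..vertex_count G}" "edge_src (ends_of G e) \<in> {1..vertex_count G}"
proof -
  have "wf_ends (vertex_count G) (ends_of G e)" using assms by (auto simp: bidirected_graph_def)
  thus "edge_tgt (ends_of G e) \<in> {1..vertex_count G}" "edge_src (ends_of G e) \<in> {1..vertex_count G}"
    by (cases "ends_of G e"; simp)+
qed

definition hom_defect :: "'e bidir_graph \<Rightarrow> ('e \<Rightarrow> complex mat) \<Rightarrow> ('e \<Rightarrow> complex mat)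
    \<Rightarrow> (bool \<Rightarrow> nat \<Rightarrow> complex mat) \<Rightarrow> 'e \<Rightarrow> bool \<Rightarrow> complex mat" where
  "hom_defect G B A X e d = (
     let j = edge_tgt (ends_of G e); i = edge_src (ends_of G e);
         p = tgt_side (ends_of G e); q = src_side (ends_of G e)
     in if d then X p j * B e - A e * X q i
        else (X (\<not> p) j)\<^sup>T * A e - B e * (X (\<not> q) i)\<^sup>T)"

definition equation_set :: "'e bidir_graph \<Rightarrow> (nat \<Rightarrow> nat) \<Rightarrow> ('e \<times> bool \<times> nat \<times> nat) set" where
  "equation_set G n = (SIGMA e:edge_set G.
     UNIV \<times> ({..<n (edge_tgt (ends_of G e))} \<times> {..<n (edge_src (ends_of G e))}))"

text \<open>The linear system whose kernel is \<open>doubled_hom\<close>, with one equation for each entry of each defect matrix.\<close>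

definition hom_map :: "'e bidir_graph \<Rightarrow> (nat \<Rightarrow> nat) \<Rightarrow> ('e \<Rightarrow> complex mat) \<Rightarrow> ('e \<Rightarrow> complex mat)
    \<Rightarrow> (bool \<times> nat \<times> nat \<times> nat \<Rightarrow> complex) \<Rightarrow> 'e \<times> bool \<times> nat \<times> nat \<Rightarrow> complex" where
  "hom_map G n B A x = (\<lambda>(e, d, a, b). if (e, d, a, b) \<in> equation_set G n
     then hom_defect G B A (block n x) e d $$ (a, b) else 0)"

context
  fixes G :: "'e bidir_graph" and n :: "nat \<Rightarrow> nat" and A :: "'e \<Rightarrow> complex mat"
  assumes G: "bidirected_graph G" and A: "matrix_rep G n A"
begin

lemma finite_equation_set: "finite (equation_set G n)"
  using G by (auto simp: equation_set_def bidirected_graph_def intro!: finite_SigmaI)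

lemma hom_map_range: "range (hom_map G n B A) \<subseteq> supported_on (equation_set G n)"
  by (auto simp: hom_map_def supported_on_def)

lemma hom_map_eq_0_iff:
  assumes B: "matrix_rep G n B"
  shows "hom_map G n B A x = 0 \<longleftrightarrow> doubled_hom G B A (block n x)"
proof -
  have "(\<forall>d. hom_defect G B A (block n x) e d
        = 0\<^sub>m (n (edge_tgt (ends_of G e))) (n (edge_src (ends_of G e))))
     \<longleftrightarrow> (let j = edge_tgt (ends_of G e); i = edge_src (ends_of G e);
         p = tgt_side (ends_of G e); q = src_side (ends_of G e)
       in block n x p j * B e = A e * block n x q i
        \<and> (block n x (\<not> p) j)\<^sup>T * A e = B e * (block n x (\<not> q) i)\<^sup>T)"
    if e: "e \<in> edge_set G" for e
  proof -
    note c = edge_matrix_carrier[OF A e] edge_matrix_carrier[OF B e]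
    note X = block_carrier[of n x]
    show ?thesis
      unfolding all_bool_eq hom_defect_def Let_def if_True if_False
      by (intro arg_cong2[where f = "(\<and>)"] diff_mat_eq_0_iff
          mult_carrier_mat[OF X c(2)] mult_carrier_mat[OF c(1) X]
          mult_carrier_mat[OF transpose_carrier_mat[THEN iffD2, OF X] c(1)]
          mult_carrier_mat[OF c(2) transpose_carrier_mat[THEN iffD2, OF X]])
  qed
  hence "doubled_hom G B A (block n x) \<longleftrightarrow> (\<forall>e\<in>edge_set G. \<forall>d. hom_defect G B A (block n x) e d
        = 0\<^sub>m (n (edge_tgt (ends_of G e))) (n (edge_src (ends_of G e))))"
    by (simp add: doubled_hom_def)
  also have "\<dots> \<longleftrightarrow> hom_map G n B A x = 0"
  proof -
    have "hom_defect G B A (block n x) e d = 0\<^sub>m (n (edge_tgt (ends_of G e))) (n (edge_src (ends_of G e)))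
       \<longleftrightarrow> (\<forall>a<n (edge_tgt (ends_of G e)). \<forall>b<n (edge_src (ends_of G e)).
              hom_defect G B A (block n x) e d $$ (a, b) = 0)"
      if e: "e \<in> edge_set G" for e d
    proof -
      note c = edge_matrix_carrier[OF A e] edge_matrix_carrier[OF B e]
      note X = block_carrier[of n x]
      have "hom_defect G B A (block n x) e d
          \<in> carrier_mat (n (edge_tgt (ends_of G e))) (n (edge_src (ends_of G e)))"
        unfolding hom_defect_def Let_def using c X
        by (cases d) (auto intro!: minus_carrier_mat)
      thus ?thesis by (auto intro!: eq_matI)
    qed
    thus ?thesis by (auto simp: hom_map_def equation_set_def fun_eq_iff)
  qed
  finally show ?thesis by simp
qed

lemma hom_defect_linear:
  assumes B: "matrix_rep G n B" and e: "e \<in> edge_set G"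
    and ab: "a < n (edge_tgt (ends_of G e))" "b < n (edge_src (ends_of G e))"
  shows "hom_defect G B A (block n (x + y)) e d $$ (a, b)
      = hom_defect G B A (block n x) e d $$ (a, b) + hom_defect G B A (block n y) e d $$ (a, b)"
    and "hom_defect G B A (block n (fscale c x)) e d $$ (a, b)
      = c * hom_defect G B A (block n x) e d $$ (a, b)"
proof -
  define j i p q where "j = edge_tgt (ends_of G e)" "i = edge_src (ends_of G e)"
    "p = tgt_side (ends_of G e)" "q = src_side (ends_of G e)"
  have AB: "A e \<in> carrier_mat (n j) (n i)" "B e \<in> carrier_mat (n j) (n i)"
    using edge_matrix_carrier[OF A e] edge_matrix_carrier[OF B e] by (auto simp: j_i_p_q_def)
  have ab': "a < n j" "b < n i" using ab by (auto simp: j_i_p_q_def)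
  note X = block_carrier[of n]
  have dims: "dim_row (block n x s k) = n k" "dim_col (block n x s k) = n k" for x s k
    by (auto simp: block_def)
  note scalar = scalar_prod_def sum.distrib sum_distrib_left algebra_simps
  show "hom_defect G B A (block n (x + y)) e d $$ (a, b)
      = hom_defect G B A (block n x) e d $$ (a, b) + hom_defect G B A (block n y) e d $$ (a, b)"
    unfolding hom_defect_def Let_def block_add j_i_p_q_def[symmetric]
    using AB ab' by (cases d) (simp_all add: dims scalar)
  show "hom_defect G B A (block n (fscale c x)) e d $$ (a, b)
      = c * hom_defect G B A (block n x) e d $$ (a, b)"
    unfolding hom_defect_def Let_def block_fscale j_i_p_q_def[symmetric]
    using AB ab' by (cases d) (simp_all add: dims scalar)
qed

lemma hom_map_linear:
  assumes B: "matrix_rep G n B"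
  shows "Vector_Spaces.linear fscale fscale (hom_map G n B A)"
proof (rule linearI_fscale)
  show "hom_map G n B A (x + y) = hom_map G n B A x + hom_map G n B A y" for x y
    by (auto simp: hom_map_def fun_eq_iff equation_set_def hom_defect_linear(1)[OF B])
  show "hom_map G n B A (fscale c x) = fscale c (hom_map G n B A x)" for c x
    by (auto simp: hom_map_def fun_eq_iff equation_set_def fscale_def
        hom_defect_linear(2)[OF B, unfolded fscale_def])
qed

text \<open>For fixed \<open>X\<close> the defect is an affine function of \<open>B\<close>, with the slope \<open>X p j * (B e - A e)\<close> or
  \<open>(A e - B e) * (X (\<not> q) i)\<^sup>T\<close>. The factor \<open>2\<close> counts these two equations of an edge.\<close>

lemma hom_map_close:
  assumes B: "matrix_rep G n B"
  shows "l1_norm (equation_set G n) (hom_map G n B A x - hom_map G n A A x)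
    \<le> 2 * (\<Sum>e\<in>edge_set G. entry_norm (B e - A e)) * l1_norm (coord_set (vertex_count G) n) x"
proof -
  let ?X = "block n x" and ?l = "l1_norm (coord_set (vertex_count G) n) x"
  let ?D = "\<lambda>e d. hom_defect G B A ?X e d - hom_defect G A A ?X e d"
  have car: "?D e d \<in> carrier_mat (n (edge_tgt (ends_of G e))) (n (edge_src (ends_of G e)))"
    and le: "entry_norm (?D e d) \<le> entry_norm (B e - A e) * ?l"
    and ix: "\<And>a b. a < n (edge_tgt (ends_of G e)) \<Longrightarrow> b < n (edge_src (ends_of G e)) \<Longrightarrow>
      hom_defect G B A ?X e d $$ (a, b) - hom_defect G A A ?X e d $$ (a, b) = ?D e d $$ (a, b)"
    if e: "e \<in> edge_set G" for e d
  proof -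
    define j i p q where "j = edge_tgt (ends_of G e)" "i = edge_src (ends_of G e)"
      "p = tgt_side (ends_of G e)" "q = src_side (ends_of G e)"
    have AB: "A e \<in> carrier_mat (n j) (n i)" "B e \<in> carrier_mat (n j) (n i)"
      using edge_matrix_carrier[OF A e] edge_matrix_carrier[OF B e] by (auto simp: j_i_p_q_def)
    have ij: "i \<in> {1..vertex_count G}" "j \<in> {1..vertex_count G}"
      using edge_ends_in[OF G e] by (auto simp: j_i_p_q_def)
    note X = block_carrier[of n x]
    have XT: "(?X s k)\<^sup>T \<in> carrier_mat (n k) (n k)" for s k using X[of s k] by simp
    have def_car: "hom_defect G A A ?X e d \<in> carrier_mat (n j) (n i)"
      unfolding hom_defect_def Let_def j_i_p_q_def[symmetric] using AB X
      by (cases d) (auto intro!: minus_carrier_mat)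
    thus "?D e d \<in> carrier_mat (n (edge_tgt (ends_of G e))) (n (edge_src (ends_of G e)))"
      "\<And>a b. a < n (edge_tgt (ends_of G e)) \<Longrightarrow> b < n (edge_src (ends_of G e)) \<Longrightarrow>
        hom_defect G B A ?X e d $$ (a, b) - hom_defect G A A ?X e d $$ (a, b) = ?D e d $$ (a, b)"
      by (auto simp: j_i_p_q_def)
    show "entry_norm (?D e d) \<le> entry_norm (B e - A e) * ?l"
    proof (cases d)
      case True
      have "?X p j * (B e - A e) = ?X p j * B e - ?X p j * A e"
        by (rule mult_minus_distrib_mat[OF X AB(2,1)])
      hence "?D e d = ?X p j * (B e - A e)"
        unfolding hom_defect_def Let_def j_i_p_q_def[symmetric] using True AB X[of p j] X[of q i]
        by (intro eq_matI) (auto simp del: index_mult_mat(1))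
      hence "entry_norm (?D e d) \<le> entry_norm (?X p j) * entry_norm (B e - A e)"
        using entry_norm_mult_le[OF X minus_carrier_mat[OF AB(1)]] by simp
      also have "\<dots> \<le> ?l * entry_norm (B e - A e)"
        by (intro mult_right_mono entry_norm_block_le ij entry_norm_nonneg)
      finally show ?thesis by (simp add: mult.commute)
    next
      case False
      have "(A e - B e) * (?X (\<not> q) i)\<^sup>T = A e * (?X (\<not> q) i)\<^sup>T - B e * (?X (\<not> q) i)\<^sup>T"
        by (rule minus_mult_distrib_mat[OF AB XT])
      hence "?D e d = (A e - B e) * (?X (\<not> q) i)\<^sup>T"
        unfolding hom_defect_def Let_def j_i_p_q_def[symmetric] using False AB XT[of "\<not> p" j] XT[of "\<not> q" i]
        by (intro eq_matI) (auto simp del: index_mult_mat(1))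
      hence "entry_norm (?D e d) \<le> entry_norm (A e - B e) * entry_norm ((?X (\<not> q) i)\<^sup>T)"
        using entry_norm_mult_le[OF minus_carrier_mat[OF AB(2)] XT] by simp
      also have "\<dots> = entry_norm (B e - A e) * entry_norm (?X (\<not> q) i)"
        by (simp only: entry_norm_minus_commute[OF AB] entry_norm_transpose)
      also have "\<dots> \<le> entry_norm (B e - A e) * ?l"
        by (intro mult_left_mono entry_norm_block_le ij entry_norm_nonneg)
      finally show ?thesis .
    qed
  qed
  have "l1_norm (equation_set G n) (hom_map G n B A x - hom_map G n A A x)
      = (\<Sum>e\<in>edge_set G. \<Sum>q\<in>UNIV \<times> ({..<n (edge_tgt (ends_of G e))} \<times> {..<n (edge_src (ends_of G e))}).
          cmod ((hom_map G n B A x - hom_map G n A A x) (e, q)))"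
    unfolding l1_norm_def equation_set_def
    using G by (subst sum.Sigma) (auto simp: bidirected_graph_def split_def)
  also have "\<dots> = (\<Sum>e\<in>edge_set G. \<Sum>d\<in>UNIV. entry_norm (?D e d))"
  proof (rule sum.cong[OF refl])
    fix e assume e: "e \<in> edge_set G"
    have "(\<Sum>d\<in>UNIV. entry_norm (?D e d)) = (\<Sum>d\<in>UNIV. \<Sum>a<n (edge_tgt (ends_of G e)).
        \<Sum>b<n (edge_src (ends_of G e)). cmod ((hom_map G n B A x - hom_map G n A A x) (e, d, a, b)))"
      unfolding entry_norm_carrier[OF car[OF e]]
      by (intro sum.cong refl) (use e in \<open>simp add: hom_map_def equation_set_def flip: ix\<close>)
    thus "(\<Sum>q\<in>UNIV \<times> ({..<n (edge_tgt (ends_of G e))} \<times> {..<n (edge_src (ends_of G e))}).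
          cmod ((hom_map G n B A x - hom_map G n A A x) (e, q))) = (\<Sum>d\<in>UNIV. entry_norm (?D e d))"
      by (simp add: sum.cartesian_product split_def)
  qed
  also have "\<dots> \<le> (\<Sum>e\<in>edge_set G. \<Sum>d\<in>(UNIV::bool set). entry_norm (B e - A e) * ?l)"
    by (intro sum_mono le)
  also have "\<dots> = 2 * (\<Sum>e\<in>edge_set G. entry_norm (B e - A e)) * ?l"
    by (simp add: sum_distrib_left sum_distrib_right mult_ac)
  finally show ?thesis .
qed

end

section \<open>Doubled morphisms near the identity\<close>

lemma doubled_hom_cong:
  assumes "bidirected_graph G" and "\<And>s i. i \<in> {1..vertex_count G} \<Longrightarrow> X s i = Y s i"
  shows "doubled_hom G B A X \<longleftrightarrow> doubled_hom G B A Y"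
proof -
  have "X s (edge_tgt (ends_of G e)) = Y s (edge_tgt (ends_of G e))"
    "X s (edge_src (ends_of G e)) = Y s (edge_src (ends_of G e))" if "e \<in> edge_set G" for s e
    using edge_ends_in[OF assms(1) that] assms(2) by auto
  thus ?thesis by (simp add: doubled_hom_def Let_def)
qed

lemma doubled_hom_id:
  assumes "bidirected_graph G" "matrix_rep G n A"
  shows "doubled_hom G A A (\<lambda>s i. 1\<^sub>m (n i))"
  using left_mult_one_mat[OF edge_matrix_carrier[OF assms(2)]]
    right_mult_one_mat[OF edge_matrix_carrier[OF assms(2)]]
  by (simp add: doubled_hom_def Let_def)

lemma doubled_hom_comp:
  assumes G: "bidirected_graph G" and A: "matrix_rep G n A" and B: "matrix_rep G n B"
    and X: "\<And>s i. i \<in> {1..vertex_count G} \<Longrightarrow> X s i \<in> carrier_mat (n i) (n i)"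
    and Y: "\<And>s i. i \<in> {1..vertex_count G} \<Longrightarrow> Y s i \<in> carrier_mat (n i) (n i)"
    and homX: "doubled_hom G A A X" and homY: "doubled_hom G B A Y"
  shows "doubled_hom G B A (\<lambda>s i. X s i * Y s i)"
  unfolding doubled_hom_def Let_def
proof (intro ballI conjI)
  fix e assume e: "e \<in> edge_set G"
  define j i p q where "j = edge_tgt (ends_of G e)" "i = edge_src (ends_of G e)"
    "p = tgt_side (ends_of G e)" "q = src_side (ends_of G e)"
  have Ae: "A e \<in> carrier_mat (n j) (n i)" and Be: "B e \<in> carrier_mat (n j) (n i)"
    using edge_matrix_carrier[OF A e] edge_matrix_carrier[OF B e] by (auto simp: j_i_p_q_def)
  have ij: "i \<in> {1..vertex_count G}" "j \<in> {1..vertex_count G}"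
    using edge_ends_in[OF G e] by (auto simp: j_i_p_q_def)
  note c = X[OF ij(1), of q] X[OF ij(1), of "\<not> q"] X[OF ij(2), of p] X[OF ij(2), of "\<not> p"]
    Y[OF ij(1), of q] Y[OF ij(1), of "\<not> q"] Y[OF ij(2), of p] Y[OF ij(2), of "\<not> p"]
  have X1: "X p j * A e = A e * X q i" "(X (\<not> p) j)\<^sup>T * A e = A e * (X (\<not> q) i)\<^sup>T"
    and Y1: "Y p j * B e = A e * Y q i" "(Y (\<not> p) j)\<^sup>T * A e = B e * (Y (\<not> q) i)\<^sup>T"
    using homX homY e by (auto simp: doubled_hom_def Let_def j_i_p_q_def)
  have "X p j * Y p j * B e = X p j * (Y p j * B e)"
    by (rule assoc_mult_mat) (use c Be in auto)
  also have "\<dots> = (X p j * A e) * Y q i"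
    unfolding Y1 by (rule assoc_mult_mat[symmetric]) (use c Ae in auto)
  also have "\<dots> = A e * (X q i * Y q i)"
    unfolding X1 by (rule assoc_mult_mat) (use c Ae in auto)
  finally show "X (tgt_side (ends_of G e)) (edge_tgt (ends_of G e)) * Y (tgt_side (ends_of G e)) (edge_tgt (ends_of G e)) * B e
    = A e * (X (src_side (ends_of G e)) (edge_src (ends_of G e)) * Y (src_side (ends_of G e)) (edge_src (ends_of G e)))"
    by (simp only: j_i_p_q_def)
  have T: "(X s k * Y s k)\<^sup>T = (Y s k)\<^sup>T * (X s k)\<^sup>T" if "k \<in> {1..vertex_count G}" for s k
    by (rule transpose_mult[OF X[OF that] Y[OF that]])
  have "(X (\<not> p) j * Y (\<not> p) j)\<^sup>T * A e = (Y (\<not> p) j)\<^sup>T * ((X (\<not> p) j)\<^sup>T * A e)"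
    unfolding T[OF ij(2)] by (rule assoc_mult_mat) (use c Ae in auto)
  also have "\<dots> = ((Y (\<not> p) j)\<^sup>T * A e) * (X (\<not> q) i)\<^sup>T"
    unfolding X1 by (rule assoc_mult_mat[symmetric]) (use c Ae in auto)
  also have "\<dots> = B e * (X (\<not> q) i * Y (\<not> q) i)\<^sup>T"
    unfolding Y1 T[OF ij(1)] by (rule assoc_mult_mat) (use c Be in auto)
  finally show "(X (\<not> tgt_side (ends_of G e)) (edge_tgt (ends_of G e)) * Y (\<not> tgt_side (ends_of G e)) (edge_tgt (ends_of G e)))\<^sup>T * A e
    = B e * (X (\<not> src_side (ends_of G e)) (edge_src (ends_of G e)) * Y (\<not> src_side (ends_of G e)) (edge_src (ends_of G e)))\<^sup>T"
    by (simp only: j_i_p_q_def)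
qed

lemma block_eq_0_imp:
  assumes x: "x \<in> supported_on (coord_set t n)"
    and z: "\<And>s i. i \<in> {1..t} \<Longrightarrow> block n x s i = 0\<^sub>m (n i) (n i)"
  shows "x = 0"
proof
  fix k :: "bool \<times> nat \<times> nat \<times> nat"
  obtain s i a b where k: "k = (s, i, a, b)" by (cases k)
  show "x k = 0 k"
  proof (cases "k \<in> coord_set t n")
    case True
    hence i: "i \<in> {1..t}" "a < n i" "b < n i" by (auto simp: k coord_set_def)
    have "block n x s i $$ (a, b) = 0" using z[OF i(1)] i by simp
    thus ?thesis using i by (simp add: block_def k)
  qed (use x k in \<open>auto simp: supported_on_def\<close>)
qed

lemma unblock_mult_linear:
  assumes Y: "\<And>s i. i \<in> {1..t} \<Longrightarrow> Y s i \<in> carrier_mat (n i) (n i)"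
  shows "Vector_Spaces.linear fscale fscale (\<lambda>x. unblock t n (\<lambda>s i. block n x s i * Y s i))"
proof (rule linearI_fscale; rule ext)
  fix x y :: "bool \<times> nat \<times> nat \<times> nat \<Rightarrow> complex" and c and k :: "bool \<times> nat \<times> nat \<times> nat"
  obtain s i a b where k: "k = (s, i, a, b)" by (cases k)
  have c': "block n x s i \<in> carrier_mat (n i) (n i)" for x by (rule block_carrier)
  show "unblock t n (\<lambda>s i. block n (x + y) s i * Y s i) k
      = (unblock t n (\<lambda>s i. block n x s i * Y s i) + unblock t n (\<lambda>s i. block n y s i * Y s i)) k"
  proof (cases "k \<in> coord_set t n")
    case True
    hence i: "i \<in> {1..t}" "a < n i" "b < n i" by (auto simp: k coord_set_def)
    have "block n (x + y) s i * Y s i = block n x s i * Y s i + block n y s i * Y s i"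
      unfolding block_add by (rule add_mult_distrib_mat[OF c' c' Y[OF i(1)]])
    thus ?thesis using True i Y[OF i(1), of s] c'
      by (simp add: unblock_def k carrier_matD[OF c'] del: index_mult_mat(1))
  qed (simp add: unblock_def k)
  show "unblock t n (\<lambda>s i. block n (fscale c x) s i * Y s i) k
      = fscale c (unblock t n (\<lambda>s i. block n x s i * Y s i)) k"
  proof (cases "k \<in> coord_set t n")
    case True
    hence i: "i \<in> {1..t}" "a < n i" "b < n i" by (auto simp: k coord_set_def)
    have "block n (fscale c x) s i * Y s i = c \<cdot>\<^sub>m (block n x s i * Y s i)"
      unfolding block_fscale by (rule mult_smult_assoc_mat[OF c' Y[OF i(1)]])
    thus ?thesis using True i Y[OF i(1), of s] c'[of x]
      by (simp add: unblock_def k fscale_def carrier_matD[OF c'] del: index_mult_mat(1))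
  qed (simp add: unblock_def k fscale_def)
qed

text \<open>This applies the perturbation of kernels to the vector of identity matrices, which lies in the kernel
  of the system for \<open>(A, A)\<close>. Right multiplication by the invertible morphism \<open>Y\<close> from \<open>B\<close> to \<open>A\<close> maps that kernel
  injectively into the kernel for \<open>(B, A)\<close>. The constant \<open>C\<close> serves both as the bound on the
  distance and as the inverse of the radius of validity.\<close>

lemma doubled_hom_near_id:
  assumes G: "bidirected_graph G" and A: "matrix_rep G n A"
  obtains C where "C > 0"
    "\<And>B Y. \<lbrakk>matrix_rep G n B; doubled_hom G B A Y;
        \<And>s i. i \<in> {1..vertex_count G} \<Longrightarrow> Y s i \<in> carrier_mat (n i) (n i)
          \<and> (\<exists>Z\<in>carrier_mat (n i) (n i). Y s i * Z = 1\<^sub>m (n i));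
        C * (\<Sum>e\<in>edge_set G. entry_norm (B e - A e)) \<le> 1\<rbrakk>
      \<Longrightarrow> \<exists>X. doubled_hom G B A X \<and> (\<forall>s. \<forall>i\<in>{1..vertex_count G}.
            X s i \<in> carrier_mat (n i) (n i) \<and>
            entry_norm (X s i - 1\<^sub>m (n i)) \<le> C * (\<Sum>e\<in>edge_set G. entry_norm (B e - A e)))"
proof -
  let ?t = "vertex_count G"
  let ?K = "coord_set ?t n" and ?J = "equation_set G n"
  define v where "v = unblock ?t n (\<lambda>s i. 1\<^sub>m (n i))"
  have v: "v \<in> supported_on ?K" unfolding v_def by (rule unblock_supported)
  have vb: "block n v s i = 1\<^sub>m (n i)" if "i \<in> {1..?t}" for s i
    unfolding v_def by (rule block_unblock[OF that]) simp
  have v0: "hom_map G n A A v = 0"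
    unfolding hom_map_eq_0_iff[OF G A A]
    by (rule iffD2[OF doubled_hom_cong[OF G] doubled_hom_id[OF G A]]) (rule vb)
  obtain C where C: "C > 0"
    "\<And>L T \<delta> v. \<lbrakk>Vector_Spaces.linear fscale fscale L; range L \<subseteq> supported_on ?J;
        Vector_Spaces.linear fscale fscale T;
        \<And>x. x \<in> supported_on ?K \<Longrightarrow> hom_map G n A A x = 0 \<Longrightarrow> T x \<in> supported_on ?K \<and> L (T x) = 0;
        \<And>x. x \<in> supported_on ?K \<Longrightarrow> hom_map G n A A x = 0 \<Longrightarrow> T x = 0 \<Longrightarrow> x = 0;
        \<And>x. x \<in> supported_on ?K \<Longrightarrow> l1_norm ?J (L x - hom_map G n A A x) \<le> \<delta> * l1_norm ?K x;
        C * \<delta> \<le> 1 / 2; v \<in> supported_on ?K; hom_map G n A A v = 0\<rbrakk>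
      \<Longrightarrow> \<exists>w\<in>supported_on ?K. L w = 0 \<and> l1_norm ?K (w - v) \<le> 2 * C * \<delta> * l1_norm ?K v"
    using kernel_perturbation[OF finite_coord_set finite_equation_set[OF G A] hom_map_linear[OF G A A]
        hom_map_range[OF G A]] by blast
  \<comment> \<open>The first summand serves the radius of validity, the second one the bound on the distance.\<close>
  define C' where "C' = 4 * C + 4 * C * l1_norm ?K v"
  have lv: "0 \<le> C * l1_norm ?K v" using C(1) l1_norm_nonneg[of ?K v] by simp
  show ?thesis
  proof (rule that)
    show "C' > 0" using C(1) lv by (simp add: C'_def)
    fix B Y
    let ?D = "\<Sum>e\<in>edge_set G. entry_norm (B e - A e)"
    assume B: "matrix_rep G n B" and homY: "doubled_hom G B A Y"
      and Y: "\<And>s i. i \<in> {1..?t} \<Longrightarrow> Y s i \<in> carrier_mat (n i) (n i)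
          \<and> (\<exists>Z\<in>carrier_mat (n i) (n i). Y s i * Z = 1\<^sub>m (n i))"
      and small: "C' * ?D \<le> 1"
    have Yc: "\<And>s i. i \<in> {1..?t} \<Longrightarrow> Y s i \<in> carrier_mat (n i) (n i)" using Y by blast
    have D0: "0 \<le> ?D" by (intro sum_nonneg entry_norm_nonneg)
    define T where "T x = unblock ?t n (\<lambda>s i. block n x s i * Y s i)" for x
    have Tb: "block n (T x) s i = block n x s i * Y s i" if "i \<in> {1..?t}" for x s i
      unfolding T_def by (rule block_unblock[OF that]) (rule mult_carrier_mat[OF block_carrier[of n x s i] Yc[OF that]])
    have "\<exists>w\<in>supported_on ?K. hom_map G n B A w = 0 \<and>
        l1_norm ?K (w - v) \<le> 2 * C * (2 * ?D) * l1_norm ?K v"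
    proof (rule C(2))
      show "Vector_Spaces.linear fscale fscale (hom_map G n B A)" by (rule hom_map_linear[OF G A B])
      show "range (hom_map G n B A) \<subseteq> supported_on ?J" by (rule hom_map_range[OF G A])
      show "Vector_Spaces.linear fscale fscale T"
        unfolding T_def by (rule unblock_mult_linear[OF Yc])
      show "T x \<in> supported_on ?K \<and> hom_map G n B A (T x) = 0"
        if "hom_map G n A A x = 0" for x
      proof
        show "T x \<in> supported_on ?K" unfolding T_def by (rule unblock_supported)
        have homx: "doubled_hom G A A (block n x)" using that hom_map_eq_0_iff[OF G A A] by blast
        have comp: "doubled_hom G B A (\<lambda>s i. block n x s i * Y s i)"
          by (rule doubled_hom_comp[OF G A B _ Yc homx homY]) (rule block_carrier)
        show "hom_map G n B A (T x) = 0"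
          unfolding hom_map_eq_0_iff[OF G A B]
          by (rule iffD2[OF doubled_hom_cong[OF G] comp]) (rule Tb)
      qed
      show "x = 0" if x: "x \<in> supported_on ?K" and Tx: "T x = 0" for x
      proof (rule block_eq_0_imp[OF x])
        fix s i assume i: "i \<in> {1..?t}"
        obtain Z where Z: "Z \<in> carrier_mat (n i) (n i)" "Y s i * Z = 1\<^sub>m (n i)" using Y[OF i] by blast
        have "block n x s i = block n x s i * (Y s i * Z)"
          unfolding Z(2) by (rule right_mult_one_mat[symmetric, OF block_carrier[of n x s i]])
        also have "\<dots> = (block n x s i * Y s i) * Z"
          by (rule assoc_mult_mat[symmetric, OF block_carrier[of n x s i] Yc[OF i] Z(1)])
        also have "block n x s i * Y s i = 0\<^sub>m (n i) (n i)"
          unfolding Tb[OF i, symmetric] Tx by (intro eq_matI) (auto simp: block_def)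
        finally show "block n x s i = 0\<^sub>m (n i) (n i)" using Z(1) by simp
      qed
      show "l1_norm ?J (hom_map G n B A x - hom_map G n A A x) \<le> 2 * ?D * l1_norm ?K x" for x
        by (rule hom_map_close[OF G A B])
      have "4 * C * ?D \<le> C' * ?D"
        using lv D0 by (intro mult_right_mono) (auto simp: C'_def)
      thus "C * (2 * ?D) \<le> 1 / 2" using small by linarith
    qed (fact v v0)+
    then obtain w where w: "hom_map G n B A w = 0" "l1_norm ?K (w - v) \<le> 2 * C * (2 * ?D) * l1_norm ?K v"
      by blast
    have "4 * C * l1_norm ?K v * ?D \<le> C' * ?D"
      using C(1) D0 by (intro mult_right_mono) (auto simp: C'_def)
    hence le: "l1_norm ?K (w - v) \<le> C' * ?D" using w(2) by (simp add: mult_ac)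
    have "entry_norm (block n w s i - 1\<^sub>m (n i)) \<le> C' * ?D" if i: "i \<in> {1..?t}" for s i
      using entry_norm_block_le[OF i, of n "w - v" s] le unfolding block_diff vb[OF i] by linarith
    thus "\<exists>X. doubled_hom G B A X \<and> (\<forall>s. \<forall>i\<in>{1..?t}. X s i \<in> carrier_mat (n i) (n i) \<and>
            entry_norm (X s i - 1\<^sub>m (n i)) \<le> C' * ?D)"
      using w(1) block_carrier[of n w] unfolding hom_map_eq_0_iff[OF G A B]
      by (intro exI[of _ "block n w"]) blast
  qed
qed

lemma sum_entry_norm_le_rep_norm:
  assumes G: "bidirected_graph G" and A: "matrix_rep G n A"
  obtains M where "M > 0" "\<And>B.
    (\<Sum>e\<in>edge_set G. entry_norm (B e - A e)) \<le> M * rep_norm G (rep_diff B A)"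
proof
  let ?d = "\<lambda>e. real (n (edge_tgt (ends_of G e)) * n (edge_src (ends_of G e)))"
  let ?M = "1 + (\<Sum>e\<in>edge_set G. ?d e)"
  show "?M > 0" by (simp add: add_pos_nonneg sum_nonneg)
  fix B
  have "(\<Sum>e\<in>edge_set G. entry_norm (B e - A e)) \<le> (\<Sum>e\<in>edge_set G. ?M * frob_norm (B e - A e))"
  proof (rule sum_mono)
    fix e assume e: "e \<in> edge_set G"
    have "entry_norm (B e - A e) \<le> ?d e * frob_norm (B e - A e)"
      using entry_norm_le_frob_norm[of "B e - A e"] edge_matrix_carrier[OF A e] by simp
    also have "?d e \<le> (\<Sum>e\<in>edge_set G. ?d e)"
      by (rule member_le_sum[of e]) (use e G in \<open>auto simp: bidirected_graph_def\<close>)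
    hence "?d e * frob_norm (B e - A e) \<le> ?M * frob_norm (B e - A e)"
      by (intro mult_right_mono frob_norm_nonneg) simp
    finally show "entry_norm (B e - A e) \<le> ?M * frob_norm (B e - A e)" .
  qed
  thus "(\<Sum>e\<in>edge_set G. entry_norm (B e - A e)) \<le> ?M * rep_norm G (rep_diff B A)"
    by (simp add: rep_norm_def rep_diff_def sum_distrib_left)
qed

section \<open>The Lipschitz property of isomorphisms\<close>

theorem theorem2p2:
  fixes G :: "'e bidir_graph" and n :: "nat \<Rightarrow> nat" and A :: "'e \<Rightarrow> complex mat"
  assumes "bidirected_graph G"
    and "matrix_rep G n A"
  shows "\<exists>(\<epsilon>::real) (K::real). \<epsilon> > 0 \<and> K > 0 \<and>
    (\<forall>B. matrix_rep G n B \<and> rep_isomorphic G n B A \<and> rep_norm G (rep_diff B A) < \<epsilon> \<longrightarrow>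
      (\<exists>S. mat_isomorphism G n B A S \<and>
        (\<Sum>i = 1..vertex_count G. frob_norm (S i - 1\<^sub>m (n i))) \<le> K * rep_norm G (rep_diff B A)))"
proof -
  let ?t = "vertex_count G"
  note G = assms(1) and A = assms(2)
  have t: "?t \<ge> 1" using G by (simp add: bidirected_graph_def)
  obtain M where M: "M > 0" "\<And>B.
      (\<Sum>e\<in>edge_set G. entry_norm (B e - A e)) \<le> M * rep_norm G (rep_diff B A)"
    using sum_entry_norm_le_rep_norm[OF G A] by blast
  obtain C where C: "C > 0"
    "\<And>B Y. \<lbrakk>matrix_rep G n B; doubled_hom G B A Y;
        \<And>s i. i \<in> {1..?t} \<Longrightarrow> Y s i \<in> carrier_mat (n i) (n i)
          \<and> (\<exists>Z\<in>carrier_mat (n i) (n i). Y s i * Z = 1\<^sub>m (n i));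
        C * (\<Sum>e\<in>edge_set G. entry_norm (B e - A e)) \<le> 1\<rbrakk>
      \<Longrightarrow> \<exists>X. doubled_hom G B A X \<and> (\<forall>s. \<forall>i\<in>{1..?t}. X s i \<in> carrier_mat (n i) (n i) \<and>
            entry_norm (X s i - 1\<^sub>m (n i)) \<le> C * (\<Sum>e\<in>edge_set G. entry_norm (B e - A e)))"
  proof (rule doubled_hom_near_id[OF G A], goal_cases)
    case (1 C)
    show thesis by (rule 1(1)) (use 1(2) in simp, rule 1(3))
  qed
  show ?thesis
  proof (rule exI[of _ "1 / (12 * C * M)"], rule exI[of _ "real ?t * (8 * (C * M))"], intro conjI allI impI)
    show "0 < 1 / (12 * C * M)" "0 < real ?t * (8 * (C * M))" using C(1) M(1) t by auto
    fix B assume asm: "matrix_rep G n B \<and> rep_isomorphic G n B A \<and> rep_norm G (rep_diff B A) < 1 / (12 * C * M)"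
    hence B: "matrix_rep G n B" by blast
    define \<eta> where "\<eta> = C * (M * rep_norm G (rep_diff B A))"
    have \<eta>: "\<eta> \<le> 1 / 12" using asm C(1) M(1) by (simp add: \<eta>_def field_simps)
    have D: "C * (\<Sum>e\<in>edge_set G. entry_norm (B e - A e)) \<le> \<eta>"
      unfolding \<eta>_def using M(2)[of B] C(1) by (intro mult_left_mono) auto
    obtain S0 where S0: "mat_isomorphism G n B A S0"
      using rep_isomorphic_imp_mat_isomorphism[OF G B] asm by blast
    have S0c: "S0 i \<in> carrier_mat (n i) (n i)" "invertible_mat (S0 i)" if "i \<in> {1..?t}" for i
      using S0 that unfolding mat_isomorphism_iff[OF G B A] by auto
    have "\<exists>S'. S' \<in> carrier_mat (n i) (n i) \<and> S0 i * S' = 1\<^sub>m (n i) \<and> S' * S0 i = 1\<^sub>m (n i)"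
      if "i \<in> {1..?t}" for i
      using invertible_matE[OF S0c(2,1)[OF that]] by blast
    then obtain S' where S': "\<And>i. i \<in> {1..?t} \<Longrightarrow>
        S' i \<in> carrier_mat (n i) (n i) \<and> S0 i * S' i = 1\<^sub>m (n i) \<and> S' i * S0 i = 1\<^sub>m (n i)"
      by metis
    let ?Y = "\<lambda>s i. if s then S0 i else (S' i)\<^sup>T"
    have "?Y s i \<in> carrier_mat (n i) (n i) \<and> (\<exists>Z\<in>carrier_mat (n i) (n i). ?Y s i * Z = 1\<^sub>m (n i))"
      if i: "i \<in> {1..?t}" for s i
    proof (cases s)
      case True
      thus ?thesis using S0c(1)[OF i] S'[OF i] by auto
    next
      case False
      have "(S' i)\<^sup>T * (S0 i)\<^sup>T = 1\<^sub>m (n i)"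
        using transpose_mult[of "S0 i" "n i" "n i" "S' i" "n i"] S0c(1)[OF i] S'[OF i] by simp
      thus ?thesis using False S0c(1)[OF i] S'[OF i] by (auto intro!: bexI[of _ "(S0 i)\<^sup>T"])
    qed
    moreover have "doubled_hom G B A ?Y" by (rule mat_isomorphism_imp_doubled_hom[OF G A B S0 S'])
    moreover have "C * (\<Sum>e\<in>edge_set G. entry_norm (B e - A e)) \<le> 1" using D \<eta> by simp
    ultimately obtain X where X: "doubled_hom G B A X" "\<And>s i. i \<in> {1..?t} \<Longrightarrow> X s i \<in> carrier_mat (n i) (n i)"
      "\<And>s i. i \<in> {1..?t} \<Longrightarrow> entry_norm (X s i - 1\<^sub>m (n i)) \<le> C * (\<Sum>e\<in>edge_set G. entry_norm (B e - A e))"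
      using C(2)[OF B, of ?Y] by blast
    have near: "entry_norm (X s i - 1\<^sub>m (n i)) \<le> \<eta>" if "i \<in> {1..?t}" for s i
      using X(3)[OF that] D by (rule order.trans)
    obtain S where S: "mat_isomorphism G n B A S"
      "\<And>i. i \<in> {1..?t} \<Longrightarrow> entry_norm (S i - 1\<^sub>m (n i)) \<le> 8 * \<eta>"
      using doubled_hom_imp_near_isomorphism[OF G A B X(2) X(1) near \<eta>] by blast
    have "(\<Sum>i = 1..?t. frob_norm (S i - 1\<^sub>m (n i))) \<le> (\<Sum>i = 1..?t. 8 * \<eta>)"
      using S(2) frob_norm_le_entry_norm by (intro sum_mono) (blast intro: order.trans)
    also have "\<dots> = real ?t * (8 * (C * M)) * rep_norm G (rep_diff B A)" by (simp add: \<eta>_def)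
    finally show "\<exists>S. mat_isomorphism G n B A S \<and>
        (\<Sum>i = 1..?t. frob_norm (S i - 1\<^sub>m (n i))) \<le> real ?t * (8 * (C * M)) * rep_norm G (rep_diff B A)"
      using S(1) by blast
  qed
qed

end
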